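(* Let $\gamma=(\gamma_1,\dots,\gamma_m)\in\mathbb{N}^m$, $|\gamma|=\gamma_1+\dots+\gamma_m$, and let $1<m<q<|\gamma|$. (i) There exists a positive constant $C(\gamma)$ such that for any $u\in\dot H^{1,q}_{0,\gamma}(\mathbb{R}^{|\gamma|})$, $$\sup_x\, r_\gamma(x)^{|\gamma|-q}|u(x)|^q\le C(\gamma)^q\int_{\mathbb{R}^{|\gamma|}}|\nabla u(x)|^q\,dx.\qquad( * )$$ Moreover, $u$ is a continuous function outside the set $Y(\gamma)$. (ii) If $m<q<\min\{\gamma_k:\gamma_k\ge2\}$, then inequality $( * )$ holds for any $u\in\dot H^{1,q}_\gamma(\mathbb{R}^{|\gamma|})$, and $u$ is a continuous function outside the set $Y(\gamma)$.
   Context: $\mathbb{R}^{|\gamma|}=\mathbb{R}^{\gamma_1}\times\dots\times\mathbb{R}^{\gamma_m}$ with positive integers $\gamma_j$; $r_j(x)$ is the Euclidean norm of the $j$-th block $x_j\in\mathbb{R}^{\gamma_j}$ of $x=(x_1,\dots,x_m)$. The weight is $r_\gamma(x)=\prod_{j=1}^m r_j(x)^{\frac{\gamma_j-1}{|\gamma|-m}}$ (blocks with $\gamma_j=1$ contribute the factor $1$). The group $SO(\gamma)=SO(\gamma_1)\times\dots\times SO(\gamma_m)$ acts blockwise on $\mathbb{R}^{|\gamma|}$ ($SO(1)$ is trivial). $Y(\gamma)=\bigcup_{k:\gamma_k\ge2}\{x: r_k(x)=0\}$. $\dot H^{1,q}_\gamma(\mathbb{R}^{|\gamma|})$ and $\dot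 H^{1,q}_{0,\gamma}(\mathbb{R}^{|\gamma|})$ are the completions in the norm $\|\nabla u\|_q$ of, respectively, $C^\infty_{0,\gamma}(\mathbb{R}^{|\gamma|})$ (smooth compactly supported $SO(\gamma)$-invariant functions) and $C^\infty_{0,\gamma}(\mathbb{R}^{|\gamma|}\setminus Y(\gamma))$ (smooth $SO(\gamma)$-invariant functions with compact support in $\mathbb{R}^{|\gamma|}\setminus Y(\gamma)$). As usual, continuity refers to the existence of a representative of $u$ with this property. *)

theory Defs
  imports "HOL-Analysis.Analysis"
begin

section \<open>Smooth functions, gradients and weak gradients on Euclidean space\<close>

definition partial :: "'n::finite \<Rightarrow> (real^'n \<Rightarrow> real) \<Rightarrow> real^'n \<Rightarrow> real" where
  "partial i f x = frechet_derivative f (at x) (axis i 1)"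

definition grad :: "(real^'n::finite \<Rightarrow> real) \<Rightarrow> real^'n \<Rightarrow> real^'n" where
  "grad f x = (\<chi> i. partial i f x)"

primrec C_k :: "nat \<Rightarrow> (real^'n::finite \<Rightarrow> real) \<Rightarrow> bool" where
  "C_k 0 f \<longleftrightarrow> continuous_on UNIV f"
| "C_k (Suc k) f \<longleftrightarrow> (\<forall>x. f differentiable at x) \<and> (\<forall>i. C_k k (partial i f))"

definition smooth :: "(real^'n::finite \<Rightarrow> real) \<Rightarrow> bool" where
  "smooth f \<longleftrightarrow> (\<forall>k. C_k k f)"

text \<open>Functions in \<open>test_functions \<Omega>\<close> are extended by zero to the whole space.\<close>

definition test_functions :: "(real^'n::finite) set \<Rightarrow> (real^'n \<Rightarrow> real) set" where
  "test_functions \<Omega> = {f. smooth f \<and> compact (closure {x. f x \<noteq> 0}) \<and> closure {x. f x \<noteq> 0} \<subseteq> \<Omega>}"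

definition locally_integrable :: "(real^'n::finite \<Rightarrow> real) \<Rightarrow> bool" where
  "locally_integrable u \<longleftrightarrow> (\<forall>K. compact K \<longrightarrow> set_integrable lebesgue K u)"

definition is_weak_gradient :: "(real^'n::finite \<Rightarrow> real) \<Rightarrow> (real^'n \<Rightarrow> real^'n) \<Rightarrow> bool" where
  "is_weak_gradient u G \<longleftrightarrow>
     locally_integrable u \<and> (\<forall>i. locally_integrable (\<lambda>x. G x $ i)) \<and>
     (\<forall>\<phi> \<in> test_functions UNIV. \<forall>i.
        (LINT x|lebesgue. u x * partial i \<phi> x) = - (LINT x|lebesgue. G x $ i * \<phi> x))"

text \<open>The weak gradient is unique up to null sets, so the choice below does not affect integrals.\<close>

definition weak_grad :: "(real^'n::finite \<Rightarrow> real) \<Rightarrow> real^'n \<Rightarrow> real^'n" where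
  "weak_grad u = (SOME G. is_weak_gradient u G)"

section \<open>Blocks and block rotations\<close>

text \<open>
  The space \<open>\<real>\<^bsup>\<gamma>\<^sub>1\<^esup> \<times> \<dots> \<times> \<real>\<^bsup>\<gamma>\<^sub>m\<^esup>\<close> is \<open>real^'n\<close> together with a map \<open>blk :: 'n \<Rightarrow> 'm\<close> that
  sends each coordinate to the block containing it; the block \<open>j\<close> has \<open>\<gamma> j\<close> coordinates, and
  \<open>m = CARD('m)\<close>.
\<close>

definition block_structure :: "('m::finite \<Rightarrow> nat) \<Rightarrow> ('n::finite \<Rightarrow> 'm) \<Rightarrow> bool" where
  "block_structure \<gamma> blk \<longleftrightarrow> (\<forall>j. 1 \<le> \<gamma> j \<and> card {i. blk i = j} = \<gamma> j)"

definition block_norm :: "('n::finite \<Rightarrow> 'm::finite) \<Rightarrow> 'm \<Rightarrow> real^'n \<Rightarrow> real" where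
  "block_norm blk j x = L2_set (\<lambda>i. x $ i) {i. blk i = j}"

text \<open>The case distinction is needed because \<open>0 powr 0 = 0\<close> in this library.\<close>

definition weight :: "('m::finite \<Rightarrow> nat) \<Rightarrow> ('n::finite \<Rightarrow> 'm) \<Rightarrow> real^'n \<Rightarrow> real" where
  "weight \<gamma> blk x =
     (\<Prod>j\<in>UNIV. if \<gamma> j = 1 then 1
        else block_norm blk j x powr ((real (\<gamma> j) - 1) / (real (\<Sum>k\<in>UNIV. \<gamma> k) - real CARD('m))))"

definition singular_set :: "('m::finite \<Rightarrow> nat) \<Rightarrow> ('n::finite \<Rightarrow> 'm) \<Rightarrow> (real^'n) set" where
  "singular_set \<gamma> blk = (\<Union>k\<in>{k. 2 \<le> \<gamma> k}. {x. block_norm blk k x = 0})"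

text \<open>
  \<open>diagonal_block blk j A\<close> is the \<open>j\<close>-th diagonal block of \<open>A\<close>, completed by the identity to an
  \<open>n \<times> n\<close> matrix; it is a rotation matrix iff the block itself belongs to \<open>SO(\<gamma>\<^sub>j)\<close>.
\<close>

definition diagonal_block :: "('n::finite \<Rightarrow> 'm::finite) \<Rightarrow> 'm \<Rightarrow> real^'n^'n \<Rightarrow> real^'n^'n" where
  "diagonal_block blk j A =
     (\<chi> i k. if blk i = j \<and> blk k = j then A $ i $ k else if i = k then 1 else 0)"

definition block_SO :: "('n::finite \<Rightarrow> 'm::finite) \<Rightarrow> (real^'n^'n) set" where
  "block_SO blk =
     {A. (\<forall>i k. blk i \<noteq> blk k \<longrightarrow> A $ i $ k = 0) \<and> (\<forall>j. rotation_matrix (diagonal_block blk j A))}"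

definition block_invariant :: "('n::finite \<Rightarrow> 'm::finite) \<Rightarrow> (real^'n \<Rightarrow> real) \<Rightarrow> bool" where
  "block_invariant blk u \<longleftrightarrow> (\<forall>A \<in> block_SO blk. \<forall>x. u (A *v x) = u x)"

section \<open>The homogeneous Sobolev spaces\<close>

definition grad_norm :: "real \<Rightarrow> (real^'n::finite \<Rightarrow> real) \<Rightarrow> real" where
  "grad_norm q f = (LINT x|lebesgue. norm (grad f x) powr q) powr (1 / q)"

text \<open>
  For \<open>1 < q < n\<close> the Sobolev inequality shows that every sequence of test functions that is Cauchy
  in \<open>grad_norm q\<close> converges in \<open>L\<^sup>1\<^sub>l\<^sub>o\<^sub>c\<close>, and two Cauchy sequences have the same limit iff they are
  equivalent. The completion of a space \<open>X\<close> of test functions is therefore realised as the set of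
  functions (not yet identified up to null sets) that are such limits.
\<close>

definition grad_completion ::
    "real \<Rightarrow> (real^'n::finite \<Rightarrow> real) set \<Rightarrow> (real^'n \<Rightarrow> real) set" where
  "grad_completion q X =
     {u. locally_integrable u \<and>
         (\<exists>\<phi>. (\<forall>n. \<phi> n \<in> X) \<and>
              (\<forall>e>0. \<exists>N. \<forall>k\<ge>N. \<forall>l\<ge>N. grad_norm q (\<lambda>x. \<phi> k x - \<phi> l x) < e) \<and>
              (\<forall>K. compact K \<longrightarrow> (\<lambda>n. LINT x:K|lebesgue. \<bar>\<phi> n x - u x\<bar>) \<longlonglongrightarrow> 0))}"

definition H_dot :: "real \<Rightarrow> ('n::finite \<Rightarrow> 'm::finite) \<Rightarrow> (real^'n \<Rightarrow> real) set" where
  "H_dot q blk = grad_completion q {f \<in> test_functions UNIV. block_invariant blk f}"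

definition H_dot_0 ::
    "real \<Rightarrow> ('m::finite \<Rightarrow> nat) \<Rightarrow> ('n::finite \<Rightarrow> 'm) \<Rightarrow> (real^'n \<Rightarrow> real) set" where
  "H_dot_0 q \<gamma> blk =
     grad_completion q {f \<in> test_functions (- singular_set \<gamma> blk). block_invariant blk f}"

text \<open>
  The supremum and the continuity refer to one and the same representative \<open>v\<close> of \<open>u\<close>; it is
  unique outside the null set \<open>singular_set \<gamma> blk\<close>, on which the weight vanishes.
\<close>

definition sup_estimate_and_continuity ::
    "real \<Rightarrow> real \<Rightarrow> ('m::finite \<Rightarrow> nat) \<Rightarrow> ('n::finite \<Rightarrow> 'm) \<Rightarrow> (real^'n \<Rightarrow> real) \<Rightarrow> bool" where
  "sup_estimate_and_continuity C q \<gamma> blk u \<longleftrightarrow>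
     (\<exists>v. (AE x in lebesgue. v x = u x) \<and>
          continuous_on (- singular_set \<gamma> blk) v \<and>
          (SUP x. ennreal (weight \<gamma> blk x powr (real (\<Sum>k\<in>UNIV. \<gamma> k) - q) * \<bar>v x\<bar> powr q))
            \<le> ennreal (C powr q * (LINT x|lebesgue. norm (weak_grad u x) powr q)))"

end

theory Submission
  imports Defs
begin

text \<open>
  An invariant function depends only on its block norms, so it is a function \<open>U\<close> of
  \<open>m < q\<close> variables \<open>s\<close>, and Lebesgue measure becomes a constant times \<open>\<Prod>\<^sub>j s\<^sub>j\<^bsup>\<gamma>\<^sub>j - 1\<^esup> ds\<close>.
  Integrate \<open>U\<close> from \<open>a = (r\<^sub>j(x))\<^sub>j\<close> to infinity along the rays \<open>a + t v\<close> and average over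
  \<open>v \<in> [1,2]\<^sup>m\<close>. For fixed \<open>t\<close>, the cube \<open>a + t [1,2]\<^sup>m\<close> has volume \<open>t\<^sup>m\<close> and density at least
  \<open>\<Prod>\<^sub>j (a\<^sub>j + t)\<^bsup>\<gamma>\<^sub>j - 1\<^esup> \<ge> max(g, t)\<^bsup>|\<gamma>| - m\<^esup>\<close> with \<open>g = r\<^sub>\<gamma>(x)\<close>, so Hoelder's inequality gives
  \<open>|u(x)| \<le> C \<parallel>\<nabla>u\<parallel>\<^sub>q \<integral> t\<^bsup>-m/q\<^esup> max(g, t)\<^bsup>-(|\<gamma>| - m)/q\<^esup> dt\<close>. The integral converges at \<open>0\<close> since
  \<open>m < q\<close> and at infinity since \<open>q < |\<gamma>|\<close>, and by scaling it equals \<open>C g\<^bsup>1 - |\<gamma>|/q\<^esup>\<close>. The rays move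
  away from the singular set, so test functions need not vanish near it. The estimate applied to
  differences of test functions gives locally uniform convergence outside the singular set.
\<close>

section \<open>Functions of class \<open>C\<^sup>1\<close>\<close>


text \<open>A single ray is a null set, and the \<open>L^q\<close> norm of the gradient says nothing
  about it; averaging over directions is what turns line integrals into a volume integral. All
  directions have components at least 1, so every radial coordinate grows along every ray and the
  density on a cube is bounded below by its value at the lower corner. The function \<open>U\<close>
  is never differentiated: \<open>lift\<close> embeds its variables as a slice of the full space, u
  is differentiated along that slice, and \<open>norm (grad u)\<close> is itself invariant, so its
  values on the slice determine its integral. A second difficulty comes from the right-hand side of
  the claim, where \<open>weak_grad u\<close> is an arbitrary choice: the \<open>L^q\<close> limit
  of the gradients has to be recognised as a weak gradient, and weak gradients have to agree almost
  everywhere. This needs enough test functions, hence the explicit bumps. The constants are not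
  sharp: elementary inequalities with a factor 2 stand in for those of Hoelder and
  Minkowski.\<close>

lemma partial_eqI: "(f has_derivative f') (at x) \<Longrightarrow> partial i f x = f' (axis i 1)"
  unfolding partial_def by (metis frechet_derivative_at)

lemma differentiable_has_derivative_grad:
  fixes f :: "real^'n::finite \<Rightarrow> real"
  assumes "f differentiable at x"
  shows "(f has_derivative (\<lambda>h. grad f x \<bullet> h)) (at x)"
proof -
  let ?D = "frechet_derivative f (at x)"
  have D: "(f has_derivative ?D) (at x)"
    using assms frechet_derivative_works by blast
  then have lin: "linear ?D"
    using has_derivative_linear by blast
  have "?D h = grad f x \<bullet> h" for h
  proof -
    have "?D h = ?D (\<Sum>i\<in>UNIV. h $ i *\<^sub>R axis i 1)"
      using basis_expansion[of h] by (simp add: scalar_mult_eq_scaleR)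
    also have "\<dots> = (\<Sum>i\<in>UNIV. h $ i * ?D (axis i 1))"
      by (simp add: linear_sum[OF lin] linear_scale[OF lin])
    finally show ?thesis
      by (simp add: grad_def partial_def inner_vec_def mult.commute)
  qed
  then have "?D = (\<lambda>h. grad f x \<bullet> h)" by blast
  then show ?thesis using D by metis
qed

lemma has_derivative_imp_grad:
  fixes f :: "real^'n::finite \<Rightarrow> real"
  assumes "(f has_derivative (\<lambda>h. g \<bullet> h)) (at x)"
  shows "grad f x = g"
  using partial_eqI[OF assms] by (simp add: grad_def vec_eq_iff inner_axis)

lemma C1_has_derivative:
  assumes "C_k (Suc 0) f"
  shows "(f has_derivative (\<lambda>h. grad f x \<bullet> h)) (at x)"
  using assms differentiable_has_derivative_grad by auto

lemma C1_line_derivative: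
  fixes f :: "real^'n::finite \<Rightarrow> real"
  assumes "C_k (Suc 0) f"
  shows "((\<lambda>t. f (x + t *\<^sub>R v)) has_real_derivative grad f (x + t *\<^sub>R v) \<bullet> v) (at t)"
proof -
  have "((\<lambda>t. f (x + t *\<^sub>R v)) has_derivative (\<lambda>s. grad f (x + t *\<^sub>R v) \<bullet> (s *\<^sub>R v))) (at t)"
    by (rule has_derivative_compose[of "\<lambda>t. x + t *\<^sub>R v", OF _ C1_has_derivative[OF assms]])
      (auto intro!: derivative_eq_intros)
  then show ?thesis
    unfolding has_field_derivative_def
    by (rule has_derivative_eq_rhs) (simp add: fun_eq_iff)
qed

lemma C1_continuous:
  assumes "C_k (Suc 0) f"
  shows "continuous_on S f"
  by (intro continuous_at_imp_continuous_on ballI has_derivative_continuous[OF C1_has_derivative[OF assms]])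

lemma C1_continuous_partial:
  assumes "C_k (Suc 0) f"
  shows "continuous_on S (partial i f)"
  using assms continuous_on_subset[OF _ subset_UNIV] by auto

lemma C1_continuous_grad:
  assumes "C_k (Suc 0) f"
  shows "continuous_on S (grad f)"
  unfolding grad_def[abs_def] using C1_continuous_partial[OF assms] by (intro continuous_on_vec_lambda)

lemma C1_I:
  fixes f :: "real^'n::finite \<Rightarrow> real"
  assumes "\<And>x. (f has_derivative (\<lambda>h. g x \<bullet> h)) (at x)" "continuous_on UNIV g"
  shows "C_k (Suc 0) f" "grad f = g"
proof -
  show g: "grad f = g"
    using has_derivative_imp_grad[OF assms(1)] by blast
  have "continuous_on UNIV (\<lambda>x. grad f x $ i)" for i
    unfolding g using assms(2) by (intro continuous_intros)
  moreover have "f differentiable at x" for x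
    using assms(1) unfolding differentiable_def by blast
  ultimately show "C_k (Suc 0) f"
    by (simp add: grad_def)
qed

lemma C1_diff:
  assumes "C_k (Suc 0) f" "C_k (Suc 0) g"
  shows "C_k (Suc 0) (\<lambda>x. f x - g x)" "grad (\<lambda>x. f x - g x) = (\<lambda>x. grad f x - grad g x)"
proof -
  have *: "((\<lambda>x. f x - g x) has_derivative (\<lambda>h. (grad f x - grad g x) \<bullet> h)) (at x)" for x
    using has_derivative_diff[OF C1_has_derivative[OF assms(1)] C1_has_derivative[OF assms(2)]]
    by (simp add: inner_diff_left)
  have c: "continuous_on UNIV (\<lambda>x. grad f x - grad g x)"
    by (intro continuous_intros C1_continuous_grad assms)
  show "C_k (Suc 0) (\<lambda>x. f x - g x)" "grad (\<lambda>x. f x - g x) = (\<lambda>x. grad f x - grad g x)"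
    using C1_I[OF * c] by blast+
qed

lemma C1_mult:
  assumes "C_k (Suc 0) f" "C_k (Suc 0) g"
  shows "C_k (Suc 0) (\<lambda>x. f x * g x)"
    "grad (\<lambda>x. f x * g x) = (\<lambda>x. f x *\<^sub>R grad g x + g x *\<^sub>R grad f x)"
proof -
  have *: "((\<lambda>x. f x * g x) has_derivative (\<lambda>h. (f x *\<^sub>R grad g x + g x *\<^sub>R grad f x) \<bullet> h)) (at x)" for x
    using has_derivative_mult[OF C1_has_derivative[OF assms(1)] C1_has_derivative[OF assms(2)]]
    by (rule has_derivative_eq_rhs) (simp add: fun_eq_iff inner_add_left)
  have c: "continuous_on UNIV (\<lambda>x. f x *\<^sub>R grad g x + g x *\<^sub>R grad f x)"
    by (intro continuous_intros C1_continuous_grad C1_continuous assms)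
  show "C_k (Suc 0) (\<lambda>x. f x * g x)"
    "grad (\<lambda>x. f x * g x) = (\<lambda>x. f x *\<^sub>R grad g x + g x *\<^sub>R grad f x)"
    using C1_I[OF * c] by blast+
qed

lemma grad_eq_0_outside:
  fixes f :: "real^'n::finite \<Rightarrow> real"
  assumes "\<And>x. R < norm x \<Longrightarrow> f x = 0" "R < norm x"
  shows "grad f x = 0"
proof -
  have "(f has_derivative (\<lambda>h. 0)) (at x)"
  proof (rule has_derivative_transform_within_open[of "\<lambda>_. 0" _ _ _ "{x. R < norm x}"])
    show "open {x::real^'n. R < norm x}"
      by (intro open_Collect_less continuous_intros)
  qed (use assms in auto)
  then show ?thesis
    using has_derivative_imp_grad[of f 0 x] by simp
qed

lemma integrable_continuous_outside:
  fixes f :: "'a::euclidean_space \<Rightarrow> 'b::euclidean_space"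
  assumes "continuous_on UNIV f" "\<And>x. R < norm x \<Longrightarrow> f x = 0"
  shows "integrable lborel f"
proof -
  have "integrable lborel (\<lambda>x. indicat_real (cball 0 R) x *\<^sub>R f x)"
    using assms(1) continuous_on_subset by (intro borel_integrable_compact) auto
  moreover have "(\<lambda>x. indicat_real (cball 0 R) x *\<^sub>R f x) = f"
    using assms(2) by (auto simp: fun_eq_iff indicator_def not_le[symmetric])
  ultimately show ?thesis
    by simp
qed

text \<open>Translation invariance makes every difference quotient integrate to zero; the quotients
  converge to the partial derivative under a common integrable bound. This gives integration by
  parts without iterated integrals.\<close>

lemma integral_partial_eq_0:
  fixes f :: "real^'n::finite \<Rightarrow> real"
  assumes C1: "C_k (Suc 0) f" and R: "\<And>x. R < norm x \<Longrightarrow> f x = 0"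
  shows "(LINT x|lborel. partial i f x) = 0"
proof -
  define h :: "nat \<Rightarrow> real" where "h k = inverse (real (Suc k))" for k
  have h: "0 < h k" "h k \<le> 1" for k
    by (auto simp: h_def field_simps)
  have h0: "h \<longlonglongrightarrow> 0"
    unfolding h_def by (rule LIMSEQ_inverse_real_of_nat)
  define D where "D k x = (f (x + h k *\<^sub>R axis i 1) - f x) / h k" for k x
  have cf: "continuous_on UNIV f" by (rule C1_continuous[OF C1])
  have fint: "integrable lborel f"
    by (rule integrable_continuous_outside[OF cf R])
  have Dint: "(LINT x|lborel. D k x) = 0" for k
  proof -
    let ?e = "h k *\<^sub>R axis i 1 :: real^'n"
    have i2: "integrable lborel (\<lambda>x. f (?e + x))"
    proof (rule integrable_continuous_outside[where R="R + norm ?e"])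
      show "f (?e + x) = 0" if "R + norm ?e < norm x" for x
        using that norm_diff_ineq[of x ?e] by (intro R) (simp add: add.commute)
    qed (auto intro!: continuous_on_compose2[OF cf] continuous_intros)
    have "(LINT x|lborel. f (?e + x)) = (LINT x|distr lborel borel ((+) ?e). f x)"
      by (rule integral_distr[symmetric]) (use borel_measurable_integrable[OF fint] in auto)
    also have "\<dots> = (LINT x|lborel. f x)"
      by (simp add: lborel_distr_plus)
    finally show ?thesis
      using i2 fint by (simp add: D_def add.commute)
  qed
  have cp: "continuous_on UNIV (partial i f)" by (rule C1_continuous_partial[OF C1])
  have p0: "partial i f x = 0" if "R < norm x" for x
    using grad_eq_0_outside[OF R that] by (simp add: grad_def vec_eq_iff)
  have "compact (partial i f ` cball 0 R)"
    by (intro compact_continuous_image continuous_on_subset[OF cp]) auto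
  then obtain B where B: "\<And>x. norm x \<le> R \<Longrightarrow> \<bar>partial i f x\<bar> \<le> B"
    by (force dest!: compact_imp_bounded simp: bounded_iff)
  define B' where "B' = max B 0"
  have B': "\<bar>partial i f x\<bar> \<le> B'" for x
    using B[of x] p0[of x] by (cases "norm x \<le> R") (auto simp: B'_def)
  \<comment> \<open>The steps \<open>h k\<close> are at most 1, so every quotient vanishes outside
    the ball of radius \<open>R + 1\<close>; inside it the mean value theorem rewrites the quotient
    as a value of the partial derivative.\<close>
  have bound: "\<bar>D k x\<bar> \<le> B' * indicator (cball 0 (R+1)) x" for k x
  proof (cases "norm x \<le> R + 1")
    case True
    let ?g = "\<lambda>t. f (x + t *\<^sub>R axis i 1)"
    have "(?g has_real_derivative partial i f (x + t *\<^sub>R axis i 1)) (at t)" for t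
      using C1_line_derivative[OF C1, of x "axis i 1" t] by (simp add: inner_axis grad_def)
    then obtain z where "?g (h k) - ?g 0 = (h k - 0) * partial i f (x + z *\<^sub>R axis i 1)"
      using MVT2[of 0 "h k" ?g "\<lambda>t. partial i f (x + t *\<^sub>R axis i 1)"] h by blast
    then have "D k x = partial i f (x + z *\<^sub>R axis i 1)"
      using h[of k] by (simp add: D_def)
    then show ?thesis using B' True by simp
  next
    case False
    have "norm x - 1 \<le> norm (x + h k *\<^sub>R axis i 1)"
      using norm_diff_ineq[of x "h k *\<^sub>R axis i 1"] h[of k] by simp
    then have "f (x + h k *\<^sub>R axis i 1) = 0" "f x = 0"
      using False by (auto intro!: R)
    then show ?thesis using False by (simp add: D_def)
  qed
  have lim: "(\<lambda>k. D k x) \<longlonglongrightarrow> partial i f x" for x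
  proof -
    let ?g = "\<lambda>t. f (x + t *\<^sub>R axis i 1)"
    have "(?g has_real_derivative partial i f x) (at 0)"
      using C1_line_derivative[OF C1, of x "axis i 1" 0] by (simp add: inner_axis grad_def)
    then have "((\<lambda>t. (?g t - ?g 0) / t) \<longlongrightarrow> partial i f x) (at 0)"
      by (simp add: has_field_derivative_iff)
    moreover have "filterlim h (at 0) sequentially"
      unfolding filterlim_at using h0 h(1) by (simp add: less_imp_neq[OF h(1), symmetric])
    ultimately show ?thesis
      unfolding D_def using filterlim_compose by fastforce
  qed
  have "(\<lambda>k. LINT x|lborel. D k x) \<longlonglongrightarrow> (LINT x|lborel. partial i f x)"
  proof (rule integral_dominated_convergence[where w="\<lambda>x. B' * indicator (cball 0 (R+1)) x"])
    show "D k \<in> borel_measurable lborel" for k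
      unfolding D_def
      by (simp, intro borel_measurable_continuous_onI continuous_intros continuous_on_compose2[OF cf])
        (use h(1) less_imp_neq in \<open>auto simp: less_imp_neq[symmetric]\<close>)
    show "integrable lborel (\<lambda>x. B' * indicat_real (cball 0 (R+1)) (x::real^'n))"
      using emeasure_lborel_cball_finite by (intro integrable_mult_right integrable_real_indicator) auto
  qed (use bound lim borel_measurable_continuous_onI[OF cp] in auto)
  then show ?thesis
    by (simp add: Dint LIMSEQ_const_iff)
qed

section \<open>Polar coordinates in each block\<close>


lemma bij_betw_axis_Basis: "bij_betw (\<lambda>i. axis i (1::real)) (UNIV::'n::finite set) Basis"
  unfolding bij_betw_def
proof
  show "inj (\<lambda>i::'n. axis i (1::real))"
    by (auto simp: inj_on_def axis_eq_axis)
  show "range (\<lambda>i::'n. axis i (1::real)) = Basis"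
    by (auto simp: Basis_vec_def)
qed

lemma measurable_vec_lambda_PiM [measurable]:
  "(\<lambda>f. \<chi> i. f i) \<in> Pi\<^sub>M (UNIV::'n::finite set) (\<lambda>_. lborel) \<rightarrow>\<^sub>M (borel :: (real^'n) measure)"
proof (rule borel_measurable_euclidean_space[THEN iffD2], intro ballI)
  fix b :: "real^'n" assume "b \<in> Basis"
  then obtain i where "b = axis i 1" by (auto simp: Basis_vec_def)
  then show "(\<lambda>f. (\<chi> i. f i) \<bullet> b) \<in> borel_measurable (Pi\<^sub>M UNIV (\<lambda>_. lborel))"
    by (simp add: inner_axis)
qed

text \<open>Indexing the product by the coordinates \<open>'n\<close> instead of by basis vectors
  lets the blocks appear as subsets of the index set.\<close>

lemma lborel_vec_eq_distr_PiM:
  "(lborel :: (real^'n::finite) measure) = distr (Pi\<^sub>M UNIV (\<lambda>_. lborel)) borel (\<lambda>f. \<chi> i. f i)"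
proof (rule lborel_eqI)
  interpret product_sigma_finite "\<lambda>_::'n. lborel :: real measure" ..
  fix l u :: "real^'n" assume lu: "\<And>b. b \<in> Basis \<Longrightarrow> l \<bullet> b \<le> u \<bullet> b"
  have le: "l $ i \<le> u $ i" for i
    using lu[of "axis i 1"] by (simp add: inner_axis axis_in_Basis_iff)
  have "(\<lambda>f. \<chi> i. f i) -` box l u \<inter> space (Pi\<^sub>M UNIV (\<lambda>_. lborel)) = Pi\<^sub>E UNIV (\<lambda>i. {l $ i <..< u $ i})"
    by (auto simp: space_PiM mem_box_cart PiE_def extensional_def Pi_iff)
  then have "emeasure (distr (Pi\<^sub>M UNIV (\<lambda>_. lborel)) borel (\<lambda>f. \<chi> i. f i)) (box l u)
      = emeasure (Pi\<^sub>M UNIV (\<lambda>_. lborel)) (Pi\<^sub>E UNIV (\<lambda>i. {l $ i <..< u $ i}))"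
    by (simp add: emeasure_distr)
  also have "\<dots> = (\<Prod>i\<in>UNIV. ennreal (u $ i - l $ i))"
    using le by (subst emeasure_PiM) auto
  also have "\<dots> = ennreal (\<Prod>i\<in>UNIV. u $ i - l $ i)"
    using le by (simp add: prod_ennreal)
  also have "(\<Prod>i\<in>UNIV. u $ i - l $ i) = (\<Prod>b\<in>Basis. (u - l) \<bullet> b)"
    using prod.reindex_bij_betw[OF bij_betw_axis_Basis, of "\<lambda>b. (u - l) \<bullet> b", symmetric]
    by (simp add: inner_axis)
  finally show "emeasure (distr (Pi\<^sub>M UNIV (\<lambda>_. lborel)) borel (\<lambda>f. \<chi> i. f i)) (box l u)
      = (\<Prod>b\<in>Basis. (u - l) \<bullet> b)" .
qed simp

lemma nn_integral_lborel_vec: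
  fixes f :: "real^'n::finite \<Rightarrow> ennreal"
  assumes [measurable]: "f \<in> borel_measurable borel"
  shows "(\<integral>\<^sup>+x. f x \<partial>lborel) = (\<integral>\<^sup>+y. f (\<chi> i. y i) \<partial>Pi\<^sub>M UNIV (\<lambda>_. lborel))"
  by (subst lborel_vec_eq_distr_PiM) (simp add: nn_integral_distr)

text \<open>Sublevel sets of the norm are balls of known volume \<open>\<omega> r^k\<close>, the
  density is the derivative of that volume, and half-lines generate the Borel sets.\<close>

lemma distr_L2_norm_PiM:
  assumes I: "finite I" "I \<noteq> {}"
  shows "distr (Pi\<^sub>M I (\<lambda>_. lborel)) borel (\<lambda>f. sqrt (\<Sum>i\<in>I. (f i)\<^sup>2)) =
    density lborel (\<lambda>s. ennreal (card I * unit_ball_vol (card I) * s ^ (card I - 1)) * indicator {0..} s)"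
    (is "?M = ?N")
proof -
  let ?k = "card I" and ?P = "Pi\<^sub>M I (\<lambda>_. lborel :: real measure)"
  let ?\<omega> = "unit_ball_vol (real ?k)"
  have k: "0 < ?k" using I by (simp add: card_gt_0_iff)
  have w: "0 \<le> ?\<omega>" by simp
  have [measurable]: "(\<lambda>f. sqrt (\<Sum>i\<in>I. (f i)\<^sup>2)) \<in> borel_measurable ?P" by measurable
  have M: "emeasure ?M {..r} = emeasure ?P ({f. sqrt (\<Sum>i\<in>I. (f i)\<^sup>2) \<le> r} \<inter> space ?P)" for r
    by (subst emeasure_distr) (auto intro!: arg_cong[where f="emeasure ?P"])
  have M1: "emeasure ?M {..r} = ennreal (?\<omega> * r ^ ?k)" if "r > 0" for r
    using M emeasure_cball_aux[OF I(1) that] by simp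
  \<comment> \<open>The volume formula requires a positive radius. For \<open>r \<le> 0\<close> the
    sublevel set lies in every ball of radius \<epsilon>, whose volume tends to 0 because the index
    set is nonempty.\<close>
  have M0: "emeasure ?M {..r} = 0" if "r \<le> 0" for r
  proof -
    have "((\<lambda>\<epsilon>. ennreal (?\<omega> * \<epsilon> ^ ?k)) \<longlongrightarrow> ennreal (?\<omega> * 0 ^ ?k)) (at_right 0)"
      by (intro tendsto_intros)
    moreover have "\<forall>\<^sub>F \<epsilon> in at_right 0. emeasure ?M {..r} \<le> ennreal (?\<omega> * \<epsilon> ^ ?k)"
      using eventually_at_right_less[of 0]
    proof eventually_elim
      case (elim \<epsilon>)
      then have "emeasure ?M {..r} \<le> emeasure ?M {..\<epsilon>}"
        using that by (intro emeasure_mono) auto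
      then show ?case using M1[OF elim] by simp
    qed
    ultimately have "emeasure ?M {..r} \<le> ennreal (?\<omega> * 0 ^ ?k)"
      by (rule tendsto_lowerbound) simp
    then show ?thesis using k by (simp add: zero_power)
  qed
  have N: "emeasure ?N {..r} = (if 0 < r then ennreal (?\<omega> * r ^ ?k) else 0)" for r
  proof -
    have "emeasure ?N {..r} = (\<integral>\<^sup>+s. ennreal (?k * ?\<omega> * s ^ (?k - 1)) * indicator {0..r} s \<partial>lborel)"
      by (subst emeasure_density) (auto intro!: nn_integral_cong split: split_indicator)
    also have "\<dots> = (if 0 < r then ennreal (?\<omega> * r ^ ?k) else 0)"
    proof (cases "0 < r")
      case True
      have "(\<integral>\<^sup>+s. ennreal (?k * ?\<omega> * s ^ (?k - 1)) * indicator {0..r} s \<partial>lborel)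
          = ennreal (?\<omega> * r ^ ?k - ?\<omega> * 0 ^ ?k)"
        using True w
        by (intro nn_integral_FTC_Icc) (auto intro!: derivative_eq_intros)
      then show ?thesis using True k by simp
    next
      case False
      \<comment> \<open>The interval is empty or \<open>{0}\<close>. The point 0 has to be discarded
        because for \<open>?k = 1\<close> the integrand does not vanish there.\<close>
      have "AE s in lborel. ennreal (?k * ?\<omega> * s ^ (?k - 1)) * indicator {0..r} s = 0"
        by (rule eventually_mono[OF AE_lborel_singleton[of 0]]) (use False in \<open>auto split: split_indicator\<close>)
      from nn_integral_cong_AE[OF this] show ?thesis using False by simp
    qed
    finally show ?thesis .
  qed
  show ?thesis
  proof (rule measure_eqI_generator_eq[where E="range atMost" and \<Omega>=UNIV and A="\<lambda>n. {..real n}"])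
    show "Int_stable (range (atMost :: real \<Rightarrow> _))"
      by (auto simp: Int_stable_def)
    show "sets ?M = sigma_sets UNIV (range atMost)"
      by (simp add: borel_eq_atMost)
    show "sets ?N = sigma_sets UNIV (range atMost)"
      by (simp add: borel_eq_atMost)
    show "(\<Union>i. {..real i}) = UNIV"
      using real_arch_simple by auto
    show "emeasure ?M {..real i} \<noteq> \<infinity>" for i
      by (cases "real i > 0") (simp_all add: M0 M1)
    show "emeasure ?M X = emeasure ?N X" if "X \<in> range atMost" for X
      using that M0 M1 N by (auto simp: not_less)
  qed auto
qed

text \<open>Tonelli's theorem, one block at a time. The maps \<open>\<rho> j\<close> and densities
  \<open>W j\<close> stay abstract so that signed coordinates of blocks of size one and norms of
  larger blocks are treated alike.\<close>

lemma nn_integral_PiM_blocks: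
  fixes I :: "'j \<Rightarrow> 'i set" and \<rho> :: "'j \<Rightarrow> ('i \<Rightarrow> real) \<Rightarrow> real"
  assumes "finite J" and "\<And>j. j \<in> J \<Longrightarrow> finite (I j)" and "disjoint_family_on I J"
    and "\<And>j. j \<in> J \<Longrightarrow> \<rho> j \<in> Pi\<^sub>M (I j) (\<lambda>_. lborel) \<rightarrow>\<^sub>M lborel"
    and "\<And>j. j \<in> J \<Longrightarrow> W j \<in> borel_measurable lborel"
    and "\<And>j g. j \<in> J \<Longrightarrow> g \<in> borel_measurable lborel \<Longrightarrow>
      (\<integral>\<^sup>+f. g (\<rho> j f) \<partial>Pi\<^sub>M (I j) (\<lambda>_. lborel)) = (\<integral>\<^sup>+s. g s * W j s \<partial>lborel)"
    and "h \<in> borel_measurable (Pi\<^sub>M J (\<lambda>_. lborel))"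
  shows "(\<integral>\<^sup>+f. h (\<lambda>j\<in>J. \<rho> j (restrict f (I j))) \<partial>Pi\<^sub>M (\<Union>j\<in>J. I j) (\<lambda>_. lborel))
    = (\<integral>\<^sup>+s. h s * (\<Prod>j\<in>J. W j (s j)) \<partial>Pi\<^sub>M J (\<lambda>_. lborel))"
  using assms
proof (induction J arbitrary: h rule: finite_induct)
  case empty
  then show ?case by (simp add: PiM_empty nn_integral_count_space_finite)
next
  case (insert j J)
  interpret I: product_sigma_finite "\<lambda>_::'i. lborel :: real measure" ..
  interpret J: product_sigma_finite "\<lambda>_::'j. lborel :: real measure" ..
  let ?U = "\<Union>j\<in>J. I j"
  note [measurable] = insert.prems(6)
  have [measurable]: "\<rho> k \<in> Pi\<^sub>M (I k) (\<lambda>_. lborel) \<rightarrow>\<^sub>M lborel" if "k \<in> insert j J" for k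
    using insert.prems(3) that by blast
  have W [measurable]: "W k \<in> borel_measurable lborel" if "k \<in> insert j J" for k
    using insert.prems(4) that by blast
  have disj: "?U \<inter> I j = {}"
    using insert.prems(2) insert.hyps by (auto simp: disjoint_family_on_def)
  have fin: "finite ?U" "finite (I j)"
    using insert.prems(1) insert.hyps by auto
  have upd [measurable]: "(\<lambda>(x, s). x(j := s)) \<in> Pi\<^sub>M J (\<lambda>_. lborel) \<Otimes>\<^sub>M lborel \<rightarrow>\<^sub>M Pi\<^sub>M (insert j J) (\<lambda>_. lborel)"
    by (rule measurable_add_dim)
  \<comment> \<open>The last block integrated out in its new coordinate. The induction hypothesis is
    applied to this function, hence the generalisation over \<open>h\<close>.\<close>
  define h' where "h' \<xi> = (\<integral>\<^sup>+s. h (\<xi>(j := s)) * W j s \<partial>lborel)" for \<xi>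
  have Wj [measurable]: "W j \<in> borel_measurable lborel" using W by blast
  have hu [measurable]: "(\<lambda>(x, s). h (x(j := s))) \<in> borel_measurable (Pi\<^sub>M J (\<lambda>_. lborel) \<Otimes>\<^sub>M lborel)"
    using measurable_compose[OF upd insert.prems(6)] by (simp add: case_prod_unfold)
  have h' [measurable]: "h' \<in> borel_measurable (Pi\<^sub>M J (\<lambda>_. lborel))"
    unfolding h'_def by measurable
  let ?R = "\<lambda>K f. \<lambda>j\<in>K. \<rho> j (restrict f (I j))"
  have R [measurable]: "?R K \<in> Pi\<^sub>M (\<Union>j\<in>K. I j) (\<lambda>_. lborel) \<rightarrow>\<^sub>M Pi\<^sub>M K (\<lambda>_. lborel)" if "K \<subseteq> insert j J" for K
  proof (rule measurable_restrict)
    fix k assume "k \<in> K"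
    then show "(\<lambda>f. \<rho> k (restrict f (I k))) \<in> Pi\<^sub>M (\<Union>j\<in>K. I j) (\<lambda>_. lborel) \<rightarrow>\<^sub>M lborel"
      using that by (intro measurable_compose[OF measurable_restrict_subset insert.prems(3)]) auto
  qed
  have hR: "(\<lambda>f. h (?R (insert j J) f)) \<in> borel_measurable (Pi\<^sub>M (?U \<union> I j) (\<lambda>_. lborel))"
    using measurable_compose[OF R[OF order_refl] insert.prems(6)]
    by (simp only: UN_insert Un_commute[of "I j"])
  have "(\<integral>\<^sup>+f. h (?R (insert j J) f) \<partial>Pi\<^sub>M (\<Union>j\<in>insert j J. I j) (\<lambda>_. lborel))
      = (\<integral>\<^sup>+f. h (?R (insert j J) f) \<partial>Pi\<^sub>M (?U \<union> I j) (\<lambda>_. lborel))"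
    by (simp add: Un_commute)
  also have "\<dots> = (\<integral>\<^sup>+x. (\<integral>\<^sup>+y. h (?R (insert j J) (merge ?U (I j) (x, y))) \<partial>Pi\<^sub>M (I j) (\<lambda>_. lborel)) \<partial>Pi\<^sub>M ?U (\<lambda>_. lborel))"
    by (intro I.product_nn_integral_fold disj fin hR)
  also have "\<dots> = (\<integral>\<^sup>+x. (\<integral>\<^sup>+y. h ((?R J x)(j := \<rho> j y)) \<partial>Pi\<^sub>M (I j) (\<lambda>_. lborel)) \<partial>Pi\<^sub>M ?U (\<lambda>_. lborel))"
  proof (intro nn_integral_cong arg_cong[where f=h])
    fix x y assume "x \<in> space (Pi\<^sub>M ?U (\<lambda>_. lborel :: real measure))" "y \<in> space (Pi\<^sub>M (I j) (\<lambda>_. lborel :: real measure))"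
    then have y: "restrict (merge ?U (I j) (x, y)) (I j) = y"
      using disj by (auto simp: space_PiM PiE_def extensional_def merge_def fun_eq_iff)
    have x: "restrict (merge ?U (I j) (x, y)) (I k) = restrict x (I k)" if "k \<in> J" for k
      using that by (auto simp: merge_def fun_eq_iff)
    show "?R (insert j J) (merge ?U (I j) (x, y)) = (?R J x)(j := \<rho> j y)"
    proof
      fix k
      show "?R (insert j J) (merge ?U (I j) (x, y)) k = ((?R J x)(j := \<rho> j y)) k"
        by (cases "k = j"; cases "k \<in> J") (simp_all add: x y)
    qed
  qed
  also have "\<dots> = (\<integral>\<^sup>+x. h' (?R J x) \<partial>Pi\<^sub>M ?U (\<lambda>_. lborel))"
  proof (intro nn_integral_cong)
    fix x assume "x \<in> space (Pi\<^sub>M ?U (\<lambda>_. lborel :: real measure))"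
    then have "?R J x \<in> space (Pi\<^sub>M J (\<lambda>_. lborel))"
      by (simp add: space_PiM)
    then have m: "(\<lambda>s. h ((?R J x)(j := s))) \<in> borel_measurable lborel"
      using measurable_Pair2[OF hu] by simp
    show "(\<integral>\<^sup>+y. h ((?R J x)(j := \<rho> j y)) \<partial>Pi\<^sub>M (I j) (\<lambda>_. lborel)) = h' (?R J x)"
      using insert.prems(5)[OF _ m] by (simp add: h'_def)
  qed
  also have "\<dots> = (\<integral>\<^sup>+\<xi>. h' \<xi> * (\<Prod>j\<in>J. W j (\<xi> j)) \<partial>Pi\<^sub>M J (\<lambda>_. lborel))"
    using insert.prems(1-5) h' by (intro insert.IH) (auto simp: disjoint_family_on_def)
  also have "\<dots> = (\<integral>\<^sup>+\<xi>. (\<integral>\<^sup>+s. h (\<xi>(j := s)) * (\<Prod>k\<in>insert j J. W k ((\<xi>(j := s)) k)) \<partial>lborel) \<partial>Pi\<^sub>M J (\<lambda>_. lborel))"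
  proof (intro nn_integral_cong)
    fix \<xi> assume \<xi>: "\<xi> \<in> space (Pi\<^sub>M J (\<lambda>_. lborel :: real measure))"
    then have [measurable]: "(\<lambda>s. h (\<xi>(j := s))) \<in> borel_measurable lborel"
      using measurable_Pair2[OF hu] by simp
    have "(\<Prod>k\<in>insert j J. W k ((\<xi>(j := s)) k)) = W j s * (\<Prod>j\<in>J. W j (\<xi> j))" for s
      using insert.hyps by (subst prod.insert) (auto intro!: arg_cong2[where f="(*)"] prod.cong)
    then show "h' \<xi> * (\<Prod>j\<in>J. W j (\<xi> j)) = (\<integral>\<^sup>+s. h (\<xi>(j := s)) * (\<Prod>k\<in>insert j J. W k ((\<xi>(j := s)) k)) \<partial>lborel)"
      by (simp add: h'_def nn_integral_multc[symmetric] mult.assoc)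
  qed
  also have "\<dots> = (\<integral>\<^sup>+s. h s * (\<Prod>j\<in>insert j J. W j (s j)) \<partial>Pi\<^sub>M (insert j J) (\<lambda>_. lborel))"
  proof (rule J.product_nn_integral_insert[symmetric])
    have "(\<lambda>s. W k (s k)) \<in> borel_measurable (Pi\<^sub>M (insert j J) (\<lambda>_. lborel))" if "k \<in> insert j J" for k
      using that by (intro measurable_compose[where f="\<lambda>s. s k" and g="W k", OF measurable_component_singleton W]) auto
    then show "(\<lambda>s. h s * (\<Prod>j\<in>insert j J. W j (s j))) \<in> borel_measurable (Pi\<^sub>M (insert j J) (\<lambda>_. lborel))"
      by (intro borel_measurable_times_ennreal insert.prems(6) borel_measurable_prod_ennreal)
  qed (use insert.hyps in auto)
  finally show ?case .
qed

section \<open>Block rotations\<close>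


definition block_coord :: "('n::finite \<Rightarrow> 'm::finite) \<Rightarrow> 'm \<Rightarrow> 'n" where
  "block_coord blk j = (SOME i. blk i = j)"

text \<open>Blocks of size one keep their sign: no rotation acts on them.\<close>

definition radial :: "('m::finite \<Rightarrow> nat) \<Rightarrow> ('n::finite \<Rightarrow> 'm) \<Rightarrow> real^'n \<Rightarrow> real^'m" where
  "radial \<gamma> blk x = (\<chi> j. if \<gamma> j = 1 then x $ block_coord blk j else block_norm blk j x)"

text \<open>A right inverse of \<open>radial\<close> on vectors whose entries for blocks of size
  above one are nonnegative; its range is a slice that meets every orbit of the block
  rotations.\<close>

definition lift :: "('n::finite \<Rightarrow> 'm::finite) \<Rightarrow> real^'m \<Rightarrow> real^'n" where
  "lift blk s = (\<chi> i. if i = block_coord blk (blk i) then s $ blk i else 0)"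

lemma block_structure_card:
  assumes "block_structure \<gamma> blk"
  shows "1 \<le> \<gamma> j" "card {i. blk i = j} = \<gamma> j" "{i. blk i = j} \<noteq> {}"
proof -
  show *: "1 \<le> \<gamma> j" "card {i. blk i = j} = \<gamma> j"
    using assms by (auto simp: block_structure_def)
  show "{i. blk i = j} \<noteq> {}"
  proof
    assume "{i. blk i = j} = {}"
    then show False using * by (metis card.empty not_one_le_zero)
  qed
qed

lemma blk_block_coord:
  assumes "block_structure \<gamma> blk"
  shows "blk (block_coord blk j) = j"
  using block_structure_card(3)[OF assms, of j] unfolding block_coord_def by (auto intro: someI)

lemma block_eq_singleton:
  assumes "block_structure \<gamma> blk" "\<gamma> j = 1"
  shows "{i. blk i = j} = {block_coord blk j}"
proof -
  obtain i where "{i. blk i = j} = {i}"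
    using block_structure_card(2)[OF assms(1), of j] assms(2) card_1_singletonE by metis
  moreover have "block_coord blk j \<in> {i. blk i = j}"
    using blk_block_coord[OF assms(1)] by simp
  ultimately show ?thesis by auto
qed

text \<open>Since \<open>x / 0 = 0\<close>, the case \<open>v = 0\<close> is the identity.\<close>

definition householder :: "'a::real_inner \<Rightarrow> 'a \<Rightarrow> 'a" where
  "householder v y = y - (2 * (v \<bullet> y) / (v \<bullet> v)) *\<^sub>R v"

lemma orthogonal_transformation_householder:
  "orthogonal_transformation (householder (v :: 'a::euclidean_space))"
  unfolding orthogonal_transformation_def
proof
  show "linear (householder v)"
    by (rule linearI) (simp_all add: householder_def inner_add_right algebra_simps add_divide_distrib)
  show "\<forall>x y. householder v x \<bullet> householder v y = x \<bullet> y"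
  proof (intro allI)
    fix x y :: 'a
    show "householder v x \<bullet> householder v y = x \<bullet> y"
      by (cases "v = 0") (simp_all add: householder_def inner_diff_left inner_diff_right inner_commute field_simps)
  qed
qed

text \<open>This is the reflection in the perpendicular bisector of \<open>x\<close> and
  \<open>y\<close>, which passes through the origin because the norms agree.\<close>

lemma householder_diff:
  assumes "norm x = norm y"
  shows "householder (x - y) x = y"
proof (cases "x = y")
  case False
  have "(x - y) \<bullet> (x - y) = 2 * ((x - y) \<bullet> x)"
    using assms by (simp add: inner_diff_left inner_diff_right inner_commute norm_eq)
  moreover have "(x - y) \<bullet> (x - y) \<noteq> 0" using False by simp
  ultimately have "2 * ((x - y) \<bullet> x) / ((x - y) \<bullet> (x - y)) = 1" by simp
  then show ?thesis unfolding householder_def by (simp only:) simp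
qed (simp add: householder_def)

lemma det_householder_axis:
  "det (matrix (householder (axis c 1 :: real^'n::finite))) = -1"
proof -
  let ?A = "matrix (householder (axis c 1 :: real^'n))"
  have A: "?A $ i $ k = (if i = k then if i = c then -1 else 1 else 0)" for i k
    by (simp add: matrix_def householder_def inner_axis norm_axis_1) (simp add: axis_def)
  have "det ?A = (\<Prod>i\<in>UNIV. ?A $ i $ i)"
    by (rule det_diagonal) (simp add: A)
  also have "\<dots> = (\<Prod>i\<in>UNIV. if i = c then -1 else 1)"
    by (simp add: A)
  finally show ?thesis by simp
qed

text \<open>The first clause describes rows of the matrix, the second columns: outside block
  \<open>j\<close> both are those of the identity, so the matrix is block diagonal.\<close>

definition acts_on_block :: "('n::finite \<Rightarrow> 'm::finite) \<Rightarrow> 'm \<Rightarrow> (real^'n \<Rightarrow> real^'n) \<Rightarrow> bool" where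
  "acts_on_block blk j f \<longleftrightarrow>
     (\<forall>y i. blk i \<noteq> j \<longrightarrow> f y $ i = y $ i) \<and> (\<forall>k. blk k \<noteq> j \<longrightarrow> f (axis k 1) = axis k 1)"

lemma acts_on_block_householder:
  assumes "\<And>i. blk i \<noteq> j \<Longrightarrow> v $ i = 0"
  shows "acts_on_block blk j (householder v)"
  using assms by (simp add: acts_on_block_def householder_def inner_axis)

lemma acts_on_block_compose:
  "acts_on_block blk j f \<Longrightarrow> acts_on_block blk j g \<Longrightarrow> acts_on_block blk j (f \<circ> g)"
  by (simp add: acts_on_block_def)

lemma matrix_in_block_SO:
  fixes blk :: "'n::finite \<Rightarrow> 'm::finite"
  assumes f: "acts_on_block blk j f" and rot: "rotation_matrix (matrix f)"
  shows "matrix f \<in> block_SO blk"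
proof -
  have A: "matrix f $ i $ k = (if i = k then 1 else 0)" if "\<not> (blk i = j \<and> blk k = j)" for i k
    using f that by (cases "blk i = j") (auto simp: acts_on_block_def matrix_def axis_def)
  have "diagonal_block blk l (matrix f) = (if l = j then matrix f else mat 1)" for l
    using A by (auto simp: diagonal_block_def vec_eq_iff mat_def)
  moreover have "rotation_matrix (mat 1 :: real^'n^'n)"
    by (simp add: rotation_matrix_def orthogonal_matrix_id)
  moreover have "matrix f $ i $ k = 0" if "blk i \<noteq> blk k" for i k
  proof -
    have "matrix f $ i $ k = (if i = k then 1 else 0)" using that by (intro A) auto
    then show ?thesis using that by auto
  qed
  ultimately show ?thesis
    using rot by (auto simp: block_SO_def)
qed

lemma block_norm_sqr: "(block_norm blk j x)\<^sup>2 = (\<Sum>i | blk i = j. (x $ i)\<^sup>2)"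
  by (simp add: block_norm_def L2_set_def sum_nonneg)

lemma block_norm_nonneg [simp]: "0 \<le> block_norm blk j x"
  by (simp add: block_norm_def)

text \<open>A reflection within the block moves \<open>x\<close> to the target but has the wrong
  determinant in general. Size at least two provides a further coordinate \<open>c'\<close> of the
  block at which the target vanishes, and reflecting in it repairs the sign. Orthogonality of the
  whole matrix is recorded because the invariance of the gradient norm relies on it.\<close>

lemma block_rotation_exists:
  fixes blk :: "'n::finite \<Rightarrow> 'm::finite"
  assumes "block_structure \<gamma> blk" "2 \<le> \<gamma> j"
  obtains A where "A \<in> block_SO blk" "orthogonal_matrix A"
    "A *v x = (\<chi> i. if blk i = j then if i = block_coord blk j then block_norm blk j x else 0 else x $ i)"
proof -
  let ?c = "block_coord blk j"
  define b :: "real^'n" where "b = (\<chi> i. if blk i = j then if i = ?c then block_norm blk j x else 0 else x $ i)"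
  have c: "blk ?c = j" by (rule blk_block_coord[OF assms(1)])
  have "\<not> {i. blk i = j} \<subseteq> {?c}"
    using card_mono[of "{?c}" "{i. blk i = j}"] block_structure_card(2)[OF assms(1), of j] assms(2) by auto
  then obtain c' where c': "blk c' = j" "c' \<noteq> ?c" by blast
  have split: "(\<Sum>i\<in>UNIV. (y $ i)\<^sup>2) = (\<Sum>i | blk i = j. (y $ i)\<^sup>2) + (\<Sum>i | blk i \<noteq> j. (y $ i)\<^sup>2)" for y :: "real^'n"
    by (subst sum.union_disjoint[symmetric]) (auto intro!: sum.cong)
  have "(\<Sum>i | blk i = j. (b $ i)\<^sup>2) = (\<Sum>i | blk i = j. if i = ?c then (block_norm blk j x)\<^sup>2 else 0)"
    by (rule sum.cong) (auto simp: b_def)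
  also have "\<dots> = (block_norm blk j x)\<^sup>2"
    using c by simp
  finally have "(\<Sum>i\<in>UNIV. (b $ i)\<^sup>2) = (\<Sum>i\<in>UNIV. (x $ i)\<^sup>2)"
    unfolding split block_norm_sqr by (simp add: b_def)
  then have nb: "norm x = norm b"
    by (simp add: norm_vec_def L2_set_def)
  let ?f = "householder (x - b)" and ?g = "householder (axis c' 1 :: real^'n)"
  have f: "acts_on_block blk j ?f" "orthogonal_transformation ?f" "?f x = b"
    by (auto intro!: acts_on_block_householder orthogonal_transformation_householder householder_diff[OF nb]) (simp add: b_def)
  have gb: "?g b = b"
    using c' by (simp add: householder_def inner_axis' b_def)
  have g: "acts_on_block blk j ?g" "orthogonal_transformation ?g"
    using c' by (auto intro!: acts_on_block_householder orthogonal_transformation_householder simp: axis_def)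
  have lin: "linear ?f" "linear ?g"
    using f(2) g(2) by (auto simp: orthogonal_transformation_def)
  have gf: "acts_on_block blk j (?g \<circ> ?f)" "orthogonal_transformation (?g \<circ> ?f)" "(?g \<circ> ?f) x = b"
    using f g gb by (auto intro: acts_on_block_compose orthogonal_transformation_compose)
  \<comment> \<open>the reflection \<open>?g\<close> fixes the target \<open>b\<close>, so it can be used to correct the determinant\<close>
  have det: "det (matrix ?f) = 1 \<or> det (matrix (?g \<circ> ?f)) = 1"
    using det_orthogonal_matrix[of "matrix ?f"] f(2) lin
    by (auto simp: orthogonal_transformation_matrix matrix_compose det_mul det_householder_axis)
  note result = that
  have thesis if h: "acts_on_block blk j h" "orthogonal_transformation h" "h x = b" "det (matrix h) = 1" for h
  proof (rule result)
    show o: "orthogonal_matrix (matrix h)"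
      using h(2) by (simp add: orthogonal_transformation_matrix)
    show "matrix h \<in> block_SO blk"
      using h o by (intro matrix_in_block_SO) (auto simp: rotation_matrix_def)
    show "matrix h *v x = (\<chi> i. if blk i = j then if i = ?c then block_norm blk j x else 0 else x $ i)"
      using h(2,3) by (simp add: matrix_works orthogonal_transformation_def b_def)
  qed
  then show thesis using det f gf by blast
qed

text \<open>Blocks are brought to normal form one by one; \<open>y J\<close> is the point with the
  blocks in \<open>J\<close> done. The function \<open>h\<close> is general because the lemma serves
  both for \<open>u\<close> and for the norm of its gradient.\<close>

lemma block_invariant_lift_radial:
  fixes blk :: "'n::finite \<Rightarrow> 'm::finite"
  assumes bs: "block_structure \<gamma> blk"
    and inv: "\<And>A x. A \<in> block_SO blk \<Longrightarrow> orthogonal_matrix A \<Longrightarrow> h (A *v x) = h x"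
  shows "h (lift blk (radial \<gamma> blk x)) = h x"
proof -
  define y :: "'m set \<Rightarrow> real^'n" where
    "y J = (\<chi> i. if blk i \<in> J then lift blk (radial \<gamma> blk x) $ i else x $ i)" for J
  have "h (y J) = h x" if "finite J" for J
    using that
  proof (induction J rule: finite_induct)
    case empty
    then show ?case by (simp add: y_def)
  next
    case (insert j J)
    have yj: "y J $ i = x $ i" if "blk i = j" for i
      using insert.hyps that by (simp add: y_def)
    then have bn: "block_norm blk j (y J) = block_norm blk j x"
      unfolding block_norm_def by (intro L2_set_cong) auto
    show ?case
    proof (cases "\<gamma> j = 1")
      case True
      have "y (insert j J) = y J"
        using block_eq_singleton[OF bs True] yj blk_block_coord[OF bs]
        by (auto simp: y_def vec_eq_iff lift_def radial_def True)
      then show ?thesis using insert.IH by simp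
    next
      case False
      then have "2 \<le> \<gamma> j" using block_structure_card(1)[OF bs, of j] by simp
      then obtain A where A: "A \<in> block_SO blk" "orthogonal_matrix A"
        "A *v y J = (\<chi> i. if blk i = j then if i = block_coord blk j then block_norm blk j (y J) else 0 else y J $ i)"
        using block_rotation_exists[OF bs] by blast
      have "A *v y J = y (insert j J)"
        unfolding A(3) bn using False by (auto simp: y_def vec_eq_iff lift_def radial_def)
      then show ?thesis using inv[OF A(1,2), of "y J"] insert.IH by simp
    qed
  qed
  from this[of UNIV] show ?thesis
    by (simp add: y_def)
qed


section \<open>Integration in radial coordinates\<close>

lemma continuous_on_radial: "continuous_on S (radial \<gamma> blk)"
  unfolding radial_def[abs_def] block_norm_def L2_set_def
proof (rule continuous_on_vec_lambda)
  show "continuous_on S (\<lambda>x. if \<gamma> j = 1 then x $ block_coord blk j else sqrt (\<Sum>i | blk i = j. (x $ i)\<^sup>2))" for j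
    by (cases "\<gamma> j = 1") (auto intro!: continuous_intros)
qed

lemma continuous_on_lift: "continuous_on S (lift blk)"
  unfolding lift_def[abs_def]
proof (rule continuous_on_vec_lambda)
  show "continuous_on S (\<lambda>s. if i = block_coord blk (blk i) then s $ blk i else 0)" for i
    by (cases "i = block_coord blk (blk i)") (auto intro!: continuous_intros)
qed

lemma borel_measurable_radial [measurable]: "radial \<gamma> blk \<in> borel_measurable borel"
  by (intro borel_measurable_continuous_onI continuous_on_radial)

lemma borel_measurable_lift [measurable]: "lift blk \<in> borel_measurable borel"
  by (intro borel_measurable_continuous_onI continuous_on_lift)

text \<open>The factor \<open>k * unit_ball_vol k\<close> is the area of the unit sphere. A block of
  size one carries Lebesgue measure on the whole line since its radial coordinate is signed.\<close>

definition radial_density :: "nat \<Rightarrow> real \<Rightarrow> ennreal" where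
  "radial_density k s =
     (if k = 1 then 1 else ennreal (k * unit_ball_vol k * s ^ (k - 1)) * indicator {0..} s)"

lemma borel_measurable_radial_density [measurable]: "radial_density k \<in> borel_measurable borel"
  unfolding radial_density_def by (cases "k = 1") auto

lemma nn_integral_radial:
  fixes blk :: "'n::finite \<Rightarrow> 'm::finite" and f :: "real^'m \<Rightarrow> ennreal"
  assumes bs: "block_structure \<gamma> blk" and [measurable]: "f \<in> borel_measurable borel"
  shows "(\<integral>\<^sup>+x. f (radial \<gamma> blk x) \<partial>lborel) = (\<integral>\<^sup>+s. f s * (\<Prod>j\<in>UNIV. radial_density (\<gamma> j) (s $ j)) \<partial>lborel)"
proof -
  interpret product_sigma_finite "\<lambda>_::'n. lborel :: real measure" ..
  define I where "I j = {i. blk i = j}" for j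
  define \<rho> where "\<rho> j y = (if \<gamma> j = 1 then y (block_coord blk j) else sqrt (\<Sum>i\<in>I j. (y i)\<^sup>2))" for j and y :: "'n \<Rightarrow> real"
  have U: "(\<Union>j. I j) = UNIV" by (auto simp: I_def)
  have cI: "block_coord blk j \<in> I j" for j
    using blk_block_coord[OF bs] by (simp add: I_def)
  have \<rho>m: "\<rho> j \<in> Pi\<^sub>M (I j) (\<lambda>_. lborel) \<rightarrow>\<^sub>M lborel" for j
    unfolding \<rho>_def using cI[of j] by (cases "\<gamma> j = 1") auto
  have rad: "radial \<gamma> blk (\<chi> i. y i) = (\<chi> j. (\<lambda>j\<in>UNIV. \<rho> j (restrict y (I j))) j)" for y
    using cI by (auto simp: radial_def \<rho>_def vec_eq_iff block_norm_def L2_set_def I_def)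
  have "(\<integral>\<^sup>+x. f (radial \<gamma> blk x) \<partial>lborel) = (\<integral>\<^sup>+y. f (radial \<gamma> blk (\<chi> i. y i)) \<partial>Pi\<^sub>M UNIV (\<lambda>_. lborel))"
    by (rule nn_integral_lborel_vec) measurable
  also have "\<dots> = (\<integral>\<^sup>+y. f (\<chi> j. (\<lambda>j\<in>UNIV. \<rho> j (restrict y (I j))) j) \<partial>Pi\<^sub>M (\<Union>j\<in>UNIV. I j) (\<lambda>_. lborel))"
    unfolding U rad ..
  also have "\<dots> = (\<integral>\<^sup>+s. f (\<chi> j. s j) * (\<Prod>j\<in>UNIV. radial_density (\<gamma> j) (s j)) \<partial>Pi\<^sub>M UNIV (\<lambda>_. lborel))"
  proof (rule nn_integral_PiM_blocks)
    show "disjoint_family_on I UNIV"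
      by (auto simp: disjoint_family_on_def I_def)
    show "(\<lambda>s. f (\<chi> j. s j)) \<in> borel_measurable (Pi\<^sub>M UNIV (\<lambda>_. lborel))"
      by measurable
    fix j and g :: "real \<Rightarrow> ennreal" assume g: "g \<in> borel_measurable lborel"
    show "(\<integral>\<^sup>+y. g (\<rho> j y) \<partial>Pi\<^sub>M (I j) (\<lambda>_. lborel)) = (\<integral>\<^sup>+s. g s * radial_density (\<gamma> j) s \<partial>lborel)"
    proof (cases "\<gamma> j = 1")
      case True
      then have "I j = {block_coord blk j}"
        using block_eq_singleton[OF bs] by (simp add: I_def)
      then show ?thesis
        using g True product_nn_integral_singleton[of g "block_coord blk j"]
        by (simp add: \<rho>_def radial_density_def)
    next
      case False
      have card: "card (I j) = \<gamma> j" "I j \<noteq> {}"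
        using block_structure_card[OF bs, of j] by (auto simp: I_def)
      have [measurable]: "g \<in> borel_measurable borel" using g by simp
      have "(\<integral>\<^sup>+y. g (\<rho> j y) \<partial>Pi\<^sub>M (I j) (\<lambda>_. lborel))
          = (\<integral>\<^sup>+s. g s \<partial>distr (Pi\<^sub>M (I j) (\<lambda>_. lborel)) borel (\<lambda>y. sqrt (\<Sum>i\<in>I j. (y i)\<^sup>2)))"
        using False by (subst nn_integral_distr) (auto simp: \<rho>_def)
      also have "\<dots> = (\<integral>\<^sup>+s. g s \<partial>density lborel (radial_density (\<gamma> j)))"
        using distr_L2_norm_PiM[of "I j"] card False
        by (simp add: radial_density_def[abs_def])
      also have "\<dots> = (\<integral>\<^sup>+s. g s * radial_density (\<gamma> j) s \<partial>lborel)"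
        by (subst nn_integral_density) (auto simp: mult.commute)
      finally show ?thesis .
    qed
  qed (use \<rho>m in auto)
  also have "\<dots> = (\<integral>\<^sup>+s. f s * (\<Prod>j\<in>UNIV. radial_density (\<gamma> j) (s $ j)) \<partial>lborel)"
    by (subst nn_integral_lborel_vec) (auto intro!: borel_measurable_times borel_measurable_prod)
  finally show ?thesis .
qed

text \<open>The general formula would give 2 for a block of size one, counting both signs, but
  \<open>radial\<close> keeps the sign there.\<close>

definition angular_const :: "('m::finite \<Rightarrow> nat) \<Rightarrow> real" where
  "angular_const \<gamma> = (\<Prod>j\<in>UNIV. if \<gamma> j = 1 then 1 else \<gamma> j * unit_ball_vol (\<gamma> j))"

lemma angular_const_pos: "block_structure \<gamma> blk \<Longrightarrow> 0 < angular_const \<gamma>"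
  unfolding angular_const_def using block_structure_card(1)[of \<gamma> blk]
  by (intro prod_pos) (auto intro!: mult_pos_pos simp: Suc_le_eq)

lemma prod_mono_ennreal:
  fixes f g :: "'a \<Rightarrow> ennreal"
  assumes "\<And>i. f i \<le> g i"
  shows "prod f A \<le> prod g A"
  by (induction A rule: infinite_finite_induct) (auto intro!: mult_mono assms)

text \<open>The substitution \<open>s = a + t v\<close> contributes \<open>t ^ m\<close>. On the
  image \<open>B\<close> of the cube each \<open>s $ j\<close> is at least \<open>a $ j + t\<close>,
  and the density is nondecreasing in each coordinate, so its value at the lower corner bounds it
  below; the rest of the space is dropped because \<open>F\<close> is nonnegative.\<close>

lemma nn_integral_cube_le:
  fixes blk :: "'n::finite \<Rightarrow> 'm::finite" and F :: "real^'n \<Rightarrow> ennreal" and a :: "real^'m"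
  assumes bs: "block_structure \<gamma> blk" and [measurable]: "F \<in> borel_measurable borel"
    and inv: "\<And>x. F (lift blk (radial \<gamma> blk x)) = F x"
    and t: "0 < t" and a: "\<And>j. \<gamma> j \<noteq> 1 \<Longrightarrow> 0 \<le> a $ j"
  shows "ennreal (angular_const \<gamma> * t ^ CARD('m) * (\<Prod>j\<in>UNIV. (a $ j + t) ^ (\<gamma> j - 1))) *
      (\<integral>\<^sup>+v. F (lift blk (a + t *\<^sub>R v)) * indicator (cbox (vec 1) (vec 2)) v \<partial>lborel) \<le> (\<integral>\<^sup>+x. F x \<partial>lborel)"
proof -
  define B :: "(real^'m) set" where "B = {s. \<forall>j. a $ j + t \<le> s $ j \<and> s $ j \<le> a $ j + 2 * t}"
  have "closed B"
    unfolding B_def by (intro closed_Collect_all closed_Collect_conj closed_Collect_le continuous_intros)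
  then have [measurable]: "B \<in> sets borel" by (rule borel_closed)
  define C where "C = angular_const \<gamma> * (\<Prod>j\<in>UNIV. (a $ j + t) ^ (\<gamma> j - 1))"
  have pow_nonneg: "0 \<le> (a $ j + t) ^ (\<gamma> j - 1)" for j
    using a[of j] t by (cases "\<gamma> j = 1") auto
  have C: "C = (\<Prod>j\<in>UNIV. (if \<gamma> j = 1 then 1 else \<gamma> j * unit_ball_vol (\<gamma> j)) * (a $ j + t) ^ (\<gamma> j - 1))"
    by (simp add: C_def angular_const_def prod.distrib)
  have C0: "0 \<le> C"
    unfolding C using pow_nonneg by (intro prod_nonneg) auto
  have W: "ennreal C \<le> (\<Prod>j\<in>UNIV. radial_density (\<gamma> j) (s $ j))" if s: "s \<in> B" for s
  proof -
    have "ennreal C = (\<Prod>j\<in>UNIV. ennreal ((if \<gamma> j = 1 then 1 else \<gamma> j * unit_ball_vol (\<gamma> j)) * (a $ j + t) ^ (\<gamma> j - 1)))"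
      unfolding C using pow_nonneg by (subst prod_ennreal) auto
    also have "\<dots> \<le> (\<Prod>j\<in>UNIV. radial_density (\<gamma> j) (s $ j))"
    proof (rule prod_mono_ennreal)
      fix j
      show "ennreal ((if \<gamma> j = 1 then 1 else \<gamma> j * unit_ball_vol (\<gamma> j)) * (a $ j + t) ^ (\<gamma> j - 1))
          \<le> radial_density (\<gamma> j) (s $ j)"
      proof (cases "\<gamma> j = 1")
        case False
        then have "0 \<le> a $ j + t" "a $ j + t \<le> s $ j"
          using a[of j] t s by (auto simp: B_def)
        then have "(a $ j + t) ^ (\<gamma> j - 1) \<le> (s $ j) ^ (\<gamma> j - 1)" "0 \<le> s $ j"
          by (auto intro: power_mono)
        then show ?thesis using False
          by (auto simp: radial_density_def intro!: ennreal_leI mult_left_mono)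
      qed (simp add: radial_density_def)
    qed
    finally show ?thesis .
  qed
  have B_iff: "a + t *\<^sub>R v \<in> B \<longleftrightarrow> v \<in> cbox (vec 1) (vec 2)" for v
    using t by (auto simp: B_def mem_box_cart)
  have ind: "indicator (cbox (vec 1) (vec 2)) v = (indicator B (a + t *\<^sub>R v) :: ennreal)" for v
    by (simp add: indicator_def B_iff)
  have "angular_const \<gamma> * t ^ CARD('m) * (\<Prod>j\<in>UNIV. (a $ j + t) ^ (\<gamma> j - 1)) = C * t ^ CARD('m)"
    by (simp add: C_def)
  then have const: "ennreal (angular_const \<gamma> * t ^ CARD('m) * (\<Prod>j\<in>UNIV. (a $ j + t) ^ (\<gamma> j - 1)))
      = ennreal C * ennreal (t ^ CARD('m))"
    by (simp only: ennreal_mult'[OF C0])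
  have "ennreal (angular_const \<gamma> * t ^ CARD('m) * (\<Prod>j\<in>UNIV. (a $ j + t) ^ (\<gamma> j - 1))) *
      (\<integral>\<^sup>+v. F (lift blk (a + t *\<^sub>R v)) * indicator (cbox (vec 1) (vec 2)) v \<partial>lborel)
    = ennreal C * (ennreal (t ^ CARD('m)) * (\<integral>\<^sup>+v. F (lift blk (a + t *\<^sub>R v)) * indicator B (a + t *\<^sub>R v) \<partial>lborel))"
    unfolding ind const by (simp only: mult.assoc)
  also have "\<dots> = ennreal C * (\<integral>\<^sup>+s. F (lift blk s) * indicator B s \<partial>lborel)"
  proof -
    have "(\<integral>\<^sup>+s. F (lift blk s) * indicator B s \<partial>lborel)
      = (\<integral>\<^sup>+s. F (lift blk s) * indicator B s \<partial>density (distr lborel borel (\<lambda>x. a + t *\<^sub>R x)) (\<lambda>_. \<bar>t\<bar> ^ DIM(real^'m)))"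
      using lborel_affine[of t a] t by simp
    also have "\<dots> = ennreal (t ^ CARD('m)) * (\<integral>\<^sup>+v. F (lift blk (a + t *\<^sub>R v)) * indicator B (a + t *\<^sub>R v) \<partial>lborel)"
      using t by (simp add: nn_integral_density nn_integral_distr nn_integral_cmult)
    finally show ?thesis by simp
  qed
  also have "\<dots> = (\<integral>\<^sup>+s. F (lift blk s) * (ennreal C * indicator B s) \<partial>lborel)"
    by (subst nn_integral_cmult[symmetric]) (auto simp: ac_simps)
  also have "\<dots> \<le> (\<integral>\<^sup>+s. F (lift blk s) * (\<Prod>j\<in>UNIV. radial_density (\<gamma> j) (s $ j)) \<partial>lborel)"
    using W by (intro nn_integral_mono mult_left_mono) (auto split: split_indicator)
  also have "\<dots> = (\<integral>\<^sup>+x. F (lift blk (radial \<gamma> blk x)) \<partial>lborel)"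
    by (subst nn_integral_radial[OF bs, symmetric]) auto
  finally show ?thesis
    by (simp add: inv)
qed

section \<open>A weighted Morrey estimate\<close>


text \<open>Used with \<open>\<alpha> = m/q\<close> and
  \<open>\<alpha> + \<beta> = |\<gamma>|/q\<close>, so the two conditions read \<open>m < q\<close>
  and \<open>q < |\<gamma>|\<close>. The integral is split where the maximum switches, at
  \<open>t = g\<close>.\<close>

lemma nn_integral_powr_max:
  fixes \<alpha> \<beta> g :: real
  assumes g: "0 < g" and \<alpha>: "\<alpha> < 1" and \<beta>: "1 < \<alpha> + \<beta>"
  shows "(\<integral>\<^sup>+t. ennreal (t powr -\<alpha> * max g t powr -\<beta>) * indicator {0..} t \<partial>lborel)
    = ennreal (g powr (1 - \<alpha> - \<beta>) * (1 / (1 - \<alpha>) + 1 / (\<alpha> + \<beta> - 1)))"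
proof -
  have 1: "(\<integral>\<^sup>+t. indicator {0..g} t * (t powr -\<alpha>) \<partial>lborel) = ennreal (g powr (-\<alpha> + 1) / (-\<alpha> + 1))"
    by (rule nn_integral_has_integral_lebesgue[OF _ has_integral_powr_from_0]) (use assms in auto)
  have 2: "(\<integral>\<^sup>+t. indicator {g..} t * (t powr (-\<alpha>-\<beta>)) \<partial>lborel)
      = ennreal (- (g powr (-\<alpha>-\<beta>+1)) / (-\<alpha>-\<beta>+1))"
    by (rule nn_integral_has_integral_lebesgue[OF _ has_integral_powr_to_inf]) (use assms in auto)
  have "(\<integral>\<^sup>+t. ennreal (t powr -\<alpha> * max g t powr -\<beta>) * indicator {0..} t \<partial>lborel)
      = (\<integral>\<^sup>+t. ennreal (g powr -\<beta>) * ennreal (indicator {0..g} t * (t powr -\<alpha>))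
          + ennreal (indicator {g..} t * (t powr (-\<alpha>-\<beta>))) \<partial>lborel)"
  \<comment> \<open>The point \<open>g\<close> lies in both intervals and would be counted
    twice.\<close>
  proof (rule nn_integral_cong_AE, rule eventually_mono[OF AE_lborel_singleton[of g]])
    fix t :: real assume "t \<noteq> g"
    then consider "t < 0" | "0 \<le> t" "t < g" | "g < t" by linarith
    then show "ennreal (t powr -\<alpha> * max g t powr -\<beta>) * indicator {0..} t
        = ennreal (g powr -\<beta>) * ennreal (indicator {0..g} t * (t powr -\<alpha>))
          + ennreal (indicator {g..} t * (t powr (-\<alpha>-\<beta>)))"
    proof cases
      case 3
      then show ?thesis using g by (simp add: max_def powr_add[symmetric])
    qed (use g in \<open>auto simp: max_def ennreal_mult'[symmetric] mult.commute\<close>)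
  qed
  also have "\<dots> = ennreal (g powr -\<beta>) * ennreal (g powr (-\<alpha> + 1) / (-\<alpha> + 1))
      + ennreal (- (g powr (-\<alpha>-\<beta>+1)) / (-\<alpha>-\<beta>+1))"
    by (subst nn_integral_add) (auto simp: nn_integral_cmult 1 2)
  also have "\<dots> = ennreal (g powr -\<beta> * (g powr (-\<alpha> + 1) / (-\<alpha> + 1)) + - (g powr (-\<alpha>-\<beta>+1)) / (-\<alpha>-\<beta>+1))"
    using assms by (simp add: ennreal_mult'[symmetric] ennreal_plus[symmetric] divide_nonneg_nonneg divide_nonpos_nonpos divide_le_0_iff zero_le_divide_iff del: ennreal_plus)
  also have "g powr -\<beta> * (g powr (-\<alpha> + 1) / (-\<alpha> + 1)) + - (g powr (-\<alpha>-\<beta>+1)) / (-\<alpha>-\<beta>+1)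
      = g powr (1 - \<alpha> - \<beta>) * (1 / (1 - \<alpha>) + 1 / (\<alpha> + \<beta> - 1))"
  proof -
    have "g powr -\<beta> * g powr (-\<alpha> + 1) = g powr (1 - \<alpha> - \<beta>)"
      by (simp add: powr_add[symmetric])
    moreover have "- (g powr (-\<alpha>-\<beta>+1)) / (-\<alpha>-\<beta>+1) = g powr (1 - \<alpha> - \<beta>) / (\<alpha> + \<beta> - 1)"
      using \<beta> by (simp add: field_simps)
    ultimately show ?thesis by (simp add: distrib_left)
  qed
  finally show ?thesis .
qed

text \<open>Above the threshold, \<open>y = y powr (1 - q) * y powr q\<close>, and the first factor
  decreases in \<open>y\<close>. With a free \<delta> this stands in for Hoelder's
  inequality.\<close>

lemma le_plus_powr:
  fixes y \<delta> q :: real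
  assumes "0 \<le> y" "0 < \<delta>" "1 \<le> q"
  shows "y \<le> \<delta> + \<delta> powr (1 - q) * y powr q"
proof (cases "y \<le> \<delta>")
  case False
  then have "y powr (1 - q) \<le> \<delta> powr (1 - q)"
    using assms by (intro powr_mono2') auto
  then have "y powr (1 - q) * y powr q \<le> \<delta> powr (1 - q) * y powr q"
    by (rule mult_right_mono) simp
  moreover have "y powr (1 - q) * y powr q = y"
    using False assms by (simp add: powr_add[symmetric])
  ultimately show ?thesis using assms by simp
qed (use assms in \<open>simp add: add_increasing2\<close>)

text \<open>Hoelder's inequality up to the factor 2: the threshold
  \<open>\<delta> = k powr (1 / q)\<close> balances the two terms of \<open>le_plus_powr\<close>,
  each of which becomes \<delta>.\<close>

lemma nn_integral_powr_le:
  fixes f :: "'a \<Rightarrow> real"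
  assumes [measurable]: "f \<in> borel_measurable M" "V \<in> sets M" and "emeasure M V \<le> 1"
    and f: "\<And>x. 0 \<le> f x" and q: "1 \<le> q" and k: "0 < k"
    and le: "(\<integral>\<^sup>+x. ennreal (f x powr q) * indicator V x \<partial>M) \<le> ennreal k"
  shows "(\<integral>\<^sup>+x. ennreal (f x) * indicator V x \<partial>M) \<le> ennreal (2 * k powr (1 / q))"
proof -
  define \<delta> where "\<delta> = k powr (1 / q)"
  have \<delta>: "0 < \<delta>" using k by (simp add: \<delta>_def)
  have "(\<integral>\<^sup>+x. ennreal (f x) * indicator V x \<partial>M)
      \<le> (\<integral>\<^sup>+x. ennreal \<delta> * indicator V x + ennreal (\<delta> powr (1 - q)) * (ennreal (f x powr q) * indicator V x) \<partial>M)"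
  proof (rule nn_integral_mono)
    fix x
    show "ennreal (f x) * indicator V x
        \<le> ennreal \<delta> * indicator V x + ennreal (\<delta> powr (1 - q)) * (ennreal (f x powr q) * indicator V x)"
      using ennreal_leI[OF le_plus_powr[OF f[of x] \<delta> q]] \<delta>
      by (cases "x \<in> V") (auto simp: ennreal_mult'[symmetric])
  qed
  also have "\<dots> = ennreal \<delta> * emeasure M V + ennreal (\<delta> powr (1 - q)) * (\<integral>\<^sup>+x. ennreal (f x powr q) * indicator V x \<partial>M)"
    by (subst nn_integral_add) (auto simp: nn_integral_cmult)
  also have "\<dots> \<le> ennreal \<delta> * 1 + ennreal (\<delta> powr (1 - q)) * ennreal k"
    using assms by (intro add_mono mult_left_mono) auto
  also have "\<dots> = ennreal (\<delta> + \<delta> powr (1 - q) * k)"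
    using \<delta> k by (simp add: ennreal_mult'[symmetric])
  also have "\<delta> powr (1 - q) * k = \<delta>"
  proof -
    have "\<delta> powr (1 - q) * k = k powr (1 / q * (1 - q)) * k powr 1"
      using k by (simp add: \<delta>_def powr_powr)
    also have "\<dots> = k powr (1 / q * (1 - q) + 1)"
      by (simp only: powr_add)
    also have "1 / q * (1 - q) + 1 = 1 / q"
      using q by (simp add: field_simps)
    finally show ?thesis by (simp add: \<delta>_def)
  qed
  finally show ?thesis by (simp add: \<delta>_def)
qed


section \<open>Line integrals along rays and growth of the density\<close>

lemma lift_add_scaleR: "lift blk (a + t *\<^sub>R v) = lift blk a + t *\<^sub>R lift blk v"
  by (simp add: lift_def vec_eq_iff)

lemma norm_lift_le:
  fixes blk :: "'n::finite \<Rightarrow> 'm::finite"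
  assumes "v \<in> cbox (vec 1) (vec 2)"
  shows "norm (lift blk v) \<le> 2 * CARD('n)"
proof -
  have "norm (lift blk v) \<le> (\<Sum>i\<in>UNIV. \<bar>lift blk v $ i\<bar>)"
    by (rule norm_le_l1_cart)
  also have "\<dots> \<le> (\<Sum>i\<in>(UNIV::'n set). 2)"
  proof (rule sum_mono)
    fix i
    show "\<bar>lift blk v $ i\<bar> \<le> 2"
      using assms by (auto simp: lift_def mem_box_cart abs_le_iff intro: order_trans[of "- _" 0] dest!: spec[of _ "blk i"])
  qed
  finally show ?thesis by simp
qed

lemma component_le_norm_lift:
  assumes "block_structure \<gamma> blk"
  shows "s $ j \<le> norm (lift blk s)"
  using component_le_norm_cart[of "lift blk s" "block_coord blk j"] blk_block_coord[OF assms, of j]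
  by (simp add: lift_def)

text \<open>The fundamental theorem of calculus along a ray whose far end lies outside the support;
  the speed of the ray is bounded by \<open>2 * CARD('n)\<close>.\<close>

lemma C1_line_integral_bound:
  fixes blk :: "'n::finite \<Rightarrow> 'm::finite" and u :: "real^'n \<Rightarrow> real"
  assumes bs: "block_structure \<gamma> blk" and C1: "C_k (Suc 0) u"
    and R: "\<And>x. R < norm x \<Longrightarrow> u x = 0"
    and v: "v \<in> cbox (vec 1) (vec 2)"
  shows "ennreal \<bar>u (lift blk a)\<bar>
    \<le> (\<integral>\<^sup>+t. ennreal (2 * CARD('n) * norm (grad u (lift blk (a + t *\<^sub>R v)))) * indicator {0..} t \<partial>lborel)"
proof -
  \<comment> \<open>Since \<open>v $ j \<ge> 1\<close> and \<open>a $ j \<ge> - norm a\<close>, at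
    time \<open>T\<close> any single coordinate is at least \<open>\<bar>R\<bar> + 1\<close>, which
    already puts the point outside the support.\<close>
  define T where "T = \<bar>R\<bar> + norm a + 1"
  define G where "G t = grad u (lift blk a + t *\<^sub>R lift blk v) \<bullet> lift blk v" for t
  have T: "0 \<le> T" by (simp add: T_def)
  obtain j :: 'm where True by blast
  have "T * 1 \<le> T * v $ j"
    using v T by (intro mult_left_mono) (auto simp: mem_box_cart)
  moreover have "- norm a \<le> a $ j"
    using component_le_norm_cart[of a j] by simp
  ultimately have "R < (a + T *\<^sub>R v) $ j"
    by (simp add: T_def)
  also have "\<dots> \<le> norm (lift blk (a + T *\<^sub>R v))"
    by (rule component_le_norm_lift[OF bs])
  finally have uT: "u (lift blk a + T *\<^sub>R lift blk v) = 0"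
    by (simp add: R lift_add_scaleR)
  have cont: "continuous_on S G" for S
    unfolding G_def
    by (intro continuous_intros continuous_on_compose2[OF C1_continuous_grad[OF C1, of UNIV]]) auto
  have "integral\<^sup>L lborel (\<lambda>t. indicator {0..T} t *\<^sub>R G t)
      = u (lift blk a + T *\<^sub>R lift blk v) - u (lift blk a + 0 *\<^sub>R lift blk v)"
    using T C1_line_derivative[OF C1, of "lift blk a" "lift blk v"]
    by (intro integral_FTC_atLeastAtMost[OF _ _ cont])
      (auto simp: G_def has_real_derivative_iff_has_vector_derivative intro: has_vector_derivative_at_within)
  then have "\<bar>u (lift blk a)\<bar> = norm (integral\<^sup>L lborel (\<lambda>t. indicator {0..T} t *\<^sub>R G t))"
    by (simp add: uT)
  also have "ennreal \<dots> \<le> (\<integral>\<^sup>+t. norm (indicator {0..T} t *\<^sub>R G t) \<partial>lborel)"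
    by (intro integral_norm_bound_ennreal borel_integrable_compact cont) auto
  \<comment> \<open>Extending \<open>{0..T}\<close> to the half-line frees the bound from
    \<open>R\<close>, hence from the size of the support.\<close>
  also have "\<dots> \<le> (\<integral>\<^sup>+t. ennreal (2 * CARD('n) * norm (grad u (lift blk (a + t *\<^sub>R v)))) * indicator {0..} t \<partial>lborel)"
  proof (rule nn_integral_mono)
    fix t
    have "\<bar>G t\<bar> \<le> norm (grad u (lift blk (a + t *\<^sub>R v))) * norm (lift blk v)"
      unfolding G_def lift_add_scaleR by (rule Cauchy_Schwarz_ineq2)
    also have "\<dots> \<le> norm (grad u (lift blk (a + t *\<^sub>R v))) * (2 * CARD('n))"
      by (intro mult_left_mono norm_lift_le[OF v]) auto
    finally have "ennreal \<bar>G t\<bar> \<le> ennreal (2 * CARD('n) * norm (grad u (lift blk (a + t *\<^sub>R v))))"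
      by (intro ennreal_leI) (simp add: mult.commute)
    then show "ennreal (norm (indicator {0..T} t *\<^sub>R G t))
        \<le> ennreal (2 * CARD('n) * norm (grad u (lift blk (a + t *\<^sub>R v)))) * indicator {0..} t"
      by (auto split: split_indicator)
  qed
  finally show ?thesis .
qed

text \<open>By the chain rule the two gradients differ by the transpose of \<open>A\<close>, which
  is an isometry. The gradient norm can thus be evaluated on the slice and integrated in radial
  coordinates.\<close>

lemma norm_grad_invariant:
  fixes u :: "real^'n::finite \<Rightarrow> real"
  assumes C1: "C_k (Suc 0) u" and A: "orthogonal_matrix A" and inv: "\<And>x. u (A *v x) = u x"
  shows "norm (grad u (A *v x)) = norm (grad u x)"
proof -
  have "((\<lambda>x. u (A *v x)) has_derivative (\<lambda>h. grad u (A *v x) \<bullet> (A *v h))) (at x)"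
    by (rule has_derivative_compose[OF _ C1_has_derivative[OF C1]])
      (intro bounded_linear_imp_has_derivative linear_conv_bounded_linear[THEN iffD1] matrix_vector_mul_linear)
  then have "(u has_derivative (\<lambda>h. (transpose A *v grad u (A *v x)) \<bullet> h)) (at x)"
    by (simp add: inv dot_lmul_matrix[symmetric] transpose_matrix_vector)
  then have "grad u x = transpose A *v grad u (A *v x)"
    by (rule has_derivative_imp_grad)
  moreover have "orthogonal_transformation ((*v) (transpose A))"
    using A by (simp add: orthogonal_transformation_matrix)
  ultimately show ?thesis
    using orthogonal_transformation_norm by metis
qed

text \<open>Clearing the common denominator of the exponents identifies the weight with the radial
  density at \<open>x\<close>, up to the angular constant.\<close>

lemma weight_powr_eq:
  fixes blk :: "'n::finite \<Rightarrow> 'm::finite"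
  assumes bs: "block_structure \<gamma> blk" and nm: "real CARD('m) < real (\<Sum>k\<in>UNIV. \<gamma> k)"
    and x: "x \<notin> singular_set \<gamma> blk"
  shows "0 < weight \<gamma> blk x"
    and "weight \<gamma> blk x powr (real (\<Sum>k\<in>UNIV. \<gamma> k) - real CARD('m)) = (\<Prod>j\<in>UNIV. radial \<gamma> blk x $ j ^ (\<gamma> j - 1))"
proof -
  let ?d = "real (\<Sum>k\<in>UNIV. \<gamma> k) - real CARD('m)"
  have pos: "0 < block_norm blk j x" if "\<gamma> j \<noteq> 1" for j
  proof -
    have "2 \<le> \<gamma> j" using that block_structure_card(1)[OF bs, of j] by simp
    then have "block_norm blk j x \<noteq> 0" using x by (auto simp: singular_set_def)
    then show ?thesis by (simp add: order_less_le)
  qed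
  show "0 < weight \<gamma> blk x"
    unfolding weight_def using pos by (intro prod_pos) force
  have "weight \<gamma> blk x powr ?d = (\<Prod>j\<in>UNIV. (if \<gamma> j = 1 then 1 else block_norm blk j x powr ((real (\<gamma> j) - 1) / ?d)) powr ?d)"
    unfolding weight_def by (subst prod_powr_distrib) auto
  also have "\<dots> = (\<Prod>j\<in>UNIV. radial \<gamma> blk x $ j ^ (\<gamma> j - 1))"
  proof (rule prod.cong[OF refl])
    fix j
    have "block_norm blk j x powr (real (\<gamma> j) - 1) = block_norm blk j x ^ (\<gamma> j - 1)" if "\<gamma> j \<noteq> 1"
      using pos[OF that] block_structure_card(1)[OF bs, of j] by (simp add: powr_realpow[symmetric] of_nat_diff)
    then show "(if \<gamma> j = 1 then 1 else block_norm blk j x powr ((real (\<gamma> j) - 1) / ?d)) powr ?d = radial \<gamma> blk x $ j ^ (\<gamma> j - 1)"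
      using nm by (simp add: powr_powr radial_def)
  qed
  finally show "weight \<gamma> blk x powr ?d = (\<Prod>j\<in>UNIV. radial \<gamma> blk x $ j ^ (\<gamma> j - 1))" .
qed

text \<open>Each factor dominates both its value at \<open>t = 0\<close> and the pure power of
  \<open>t\<close>. The first bound yields the weight; the second yields a power of \<open>t\<close>
  with total exponent \<open>|\<gamma>| - m\<close>, the sum of the
  \<open>\<gamma> j - 1\<close>.\<close>

lemma max_weight_powr_le:
  fixes blk :: "'n::finite \<Rightarrow> 'm::finite"
  assumes bs: "block_structure \<gamma> blk" and nm: "real CARD('m) < real (\<Sum>k\<in>UNIV. \<gamma> k)"
    and x: "x \<notin> singular_set \<gamma> blk" and t: "0 < t"
  shows "max (weight \<gamma> blk x) t powr (real (\<Sum>k\<in>UNIV. \<gamma> k) - real CARD('m))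
    \<le> (\<Prod>j\<in>UNIV. (radial \<gamma> blk x $ j + t) ^ (\<gamma> j - 1))"
proof -
  let ?d = "real (\<Sum>k\<in>UNIV. \<gamma> k) - real CARD('m)"
  have r: "0 \<le> radial \<gamma> blk x $ j" if "\<gamma> j \<noteq> 1" for j
    using that by (simp add: radial_def)
  have "(\<Prod>j\<in>UNIV. radial \<gamma> blk x $ j ^ (\<gamma> j - 1)) \<le> (\<Prod>j\<in>UNIV. (radial \<gamma> blk x $ j + t) ^ (\<gamma> j - 1))"
  proof (rule prod_mono)
    fix j
    show "0 \<le> radial \<gamma> blk x $ j ^ (\<gamma> j - 1) \<and> radial \<gamma> blk x $ j ^ (\<gamma> j - 1) \<le> (radial \<gamma> blk x $ j + t) ^ (\<gamma> j - 1)"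
      using r[of j] t by (cases "\<gamma> j = 1") (auto intro: power_mono)
  qed
  moreover have "t powr ?d \<le> (\<Prod>j\<in>UNIV. (radial \<gamma> blk x $ j + t) ^ (\<gamma> j - 1))"
  proof -
    have "(\<Sum>j\<in>UNIV. \<gamma> j - 1) = (\<Sum>k\<in>UNIV. \<gamma> k) - CARD('m)"
      using block_structure_card(1)[OF bs] by (subst sum_subtractf_nat) auto
    moreover have "CARD('m) \<le> (\<Sum>k\<in>UNIV. \<gamma> k)" using nm by (simp only: of_nat_less_iff less_imp_le)
    ultimately have "t powr ?d = t ^ (\<Sum>j\<in>UNIV. \<gamma> j - 1)"
      using t by (simp add: powr_realpow[symmetric] of_nat_diff del: of_nat_sum)
    also have "\<dots> = (\<Prod>j\<in>UNIV. t ^ (\<gamma> j - 1))"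
      by (simp add: power_sum)
    also have "\<dots> \<le> (\<Prod>j\<in>UNIV. (radial \<gamma> blk x $ j + t) ^ (\<gamma> j - 1))"
    proof (rule prod_mono)
      fix j
      show "0 \<le> t ^ (\<gamma> j - 1) \<and> t ^ (\<gamma> j - 1) \<le> (radial \<gamma> blk x $ j + t) ^ (\<gamma> j - 1)"
        using r[of j] t by (cases "\<gamma> j = 1") (auto intro: power_mono)
    qed
    finally show ?thesis .
  qed
  ultimately show ?thesis
    using weight_powr_eq[OF bs nm x] by (simp add: max_def)
qed


text \<open>\<open>4 * CARD('n)\<close> is the factor 2 of \<open>nn_integral_powr_le\<close> times
  the bound \<open>2 * CARD('n)\<close> on the speed of a ray. The root comes from dividing the
  energy by the angular constant, and the last factor is the value in
  \<open>nn_integral_powr_max\<close> without the power of the weight.\<close>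

definition sup_const :: "real \<Rightarrow> ('m::finite \<Rightarrow> nat) \<Rightarrow> ('n::finite \<Rightarrow> 'm) \<Rightarrow> real" where
  "sup_const q \<gamma> blk = 4 * CARD('n) * (1 / angular_const \<gamma>) powr (1 / q) *
     (1 / (1 - CARD('m) / q) + 1 / ((\<Sum>k\<in>UNIV. \<gamma> k) / q - 1))"

lemma sup_const_pos:
  fixes blk :: "'n::finite \<Rightarrow> 'm::finite"
  assumes bs: "block_structure \<gamma> blk" and q: "1 < q" "real CARD('m) < q" "q < real (\<Sum>k\<in>UNIV. \<gamma> k)"
  shows "0 < sup_const q \<gamma> blk"
proof -
  have "0 < 1 - CARD('m) / q" "0 < real (\<Sum>k\<in>UNIV. \<gamma> k) / q - 1"
    using q by (simp_all add: field_simps)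
  then show ?thesis
    unfolding sup_const_def using angular_const_pos[OF bs]
    by (intro mult_pos_pos add_pos_pos divide_pos_pos) auto
qed

text \<open>The energy enters only through a positive upper bound \<open>E\<close>. This covers
  functions of zero energy and lets the lemma be applied to differences of test functions with any
  prescribed small bound.\<close>

lemma pointwise_estimate:
  fixes blk :: "'n::finite \<Rightarrow> 'm::finite" and u :: "real^'n \<Rightarrow> real"
  assumes bs: "block_structure \<gamma> blk"
    and q: "1 < q" "real CARD('m) < q" "q < real (\<Sum>k\<in>UNIV. \<gamma> k)"
    and C1: "C_k (Suc 0) u" and R: "\<And>x. R < norm x \<Longrightarrow> u x = 0" and inv: "block_invariant blk u"
    and x: "x \<notin> singular_set \<gamma> blk" and E: "0 < E"
    and le: "(\<integral>\<^sup>+x. ennreal (norm (grad u x) powr q) \<partial>lborel) \<le> ennreal E"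
  shows "weight \<gamma> blk x powr (real (\<Sum>k\<in>UNIV. \<gamma> k) - q) * \<bar>u x\<bar> powr q \<le> sup_const q \<gamma> blk powr q * E"
proof -
  define m where "m = real CARD('m)"
  define N where "N = real (\<Sum>k\<in>UNIV. \<gamma> k)"
  define g where "g = weight \<gamma> blk x"
  define a where "a = radial \<gamma> blk x"
  define c where "c = angular_const \<gamma>"
  define M where "M = 2 * real CARD('n)"
  define V where "V = cbox (vec 1) (vec 2 :: real^'m)"
  define f where "f t v = norm (grad u (lift blk (a + t *\<^sub>R v)))" for t and v :: "real^'m"
  have mN: "m < N" using q by (simp add: m_def N_def)
  have nm: "real CARD('m) < real (\<Sum>k\<in>UNIV. \<gamma> k)" using mN by (simp only: m_def N_def)
  have q': "0 < q" "m < q" "q < N" using q by (auto simp only: m_def N_def)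
  have c: "0 < c" using angular_const_pos[OF bs] by (simp add: c_def)
  have g: "0 < g" using weight_powr_eq(1)[OF bs nm x] by (simp add: g_def)
  have M: "0 < M" by (simp add: M_def)
  have gradm [measurable]: "grad u \<in> borel_measurable borel"
    by (intro borel_measurable_continuous_onI C1_continuous_grad[OF C1])
  have [measurable]: "V \<in> sets borel" by (simp add: V_def)
  have V1: "emeasure lborel V = 1"
  proof -
    have "(\<Prod>b\<in>Basis. (vec 2 - vec 1 :: real^'m) \<bullet> b) = 1"
      by (rule prod.neutral) (auto simp: Basis_vec_def inner_axis)
    moreover have "\<forall>b\<in>Basis. (vec 1 :: real^'m) \<bullet> b \<le> vec 2 \<bullet> b"
      by (auto simp: Basis_vec_def inner_axis)
    ultimately show ?thesis
      by (simp add: V_def emeasure_lborel_cbox_eq)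
  qed
  have inv': "u (A *v y) = u y" if "A \<in> block_SO blk" for A y
    using inv that by (simp add: block_invariant_def)
  have ua: "u (lift blk a) = u x"
    unfolding a_def by (rule block_invariant_lift_radial[OF bs]) (rule inv')
  have ga: "norm (grad u (lift blk (radial \<gamma> blk y))) = norm (grad u y)" for y
    by (rule block_invariant_lift_radial[OF bs, where h="\<lambda>y. norm (grad u y)"])
      (intro norm_grad_invariant C1 inv')
  have a0: "0 \<le> a $ j" if "\<gamma> j \<noteq> 1" for j
    using that by (simp add: a_def radial_def)
  \<comment> \<open>Angular constant and Jacobian \<open>t ^ m\<close> times a lower bound for the
    radial density on the cube; hence \<open>E / D t\<close> bounds the mean of the q-th power of
    \<open>f t\<close> over \<open>V\<close>.\<close>
  define D where "D t = c * t ^ CARD('m) * max g t powr (N - m)" for t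
  have D: "0 < D t" if "0 < t" for t
    using that c g by (simp add: D_def)
  have cube: "(\<integral>\<^sup>+v. ennreal (f t v) * indicator V v \<partial>lborel) \<le> ennreal (2 * (E / D t) powr (1 / q))" if t: "0 < t" for t
  proof (rule nn_integral_powr_le)
    let ?X = "\<integral>\<^sup>+v. ennreal (f t v powr q) * indicator V v \<partial>lborel"
    have "ennreal (D t) * ?X \<le> ennreal (c * t ^ CARD('m) * (\<Prod>j\<in>UNIV. (a $ j + t) ^ (\<gamma> j - 1))) * ?X"
      using max_weight_powr_le[OF bs nm x t] c t
      by (intro mult_right_mono ennreal_leI) (auto simp: D_def g_def a_def N_def m_def intro!: mult_left_mono)
    also have "\<dots> \<le> (\<integral>\<^sup>+x. ennreal (norm (grad u x) powr q) \<partial>lborel)"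
      unfolding c_def f_def V_def
      by (rule nn_integral_cube_le[OF bs _ _ t a0, where F="\<lambda>x. ennreal (norm (grad u x) powr q)"])
        (auto simp: ga)
    also note le
    finally have "ennreal (D t) * ?X \<le> ennreal E" .
    then have "ennreal (1 / D t) * (ennreal (D t) * ?X) \<le> ennreal (1 / D t) * ennreal E"
      by (rule mult_left_mono) simp
    also have "ennreal (1 / D t) * (ennreal (D t) * ?X) = ?X"
      using D[OF t] by (simp add: mult.assoc[symmetric] ennreal_mult'[symmetric])
    also have "ennreal (1 / D t) * ennreal E = ennreal (E / D t)"
      using D[OF t] by (simp add: ennreal_mult'[symmetric])
    finally show "?X \<le> ennreal (E / D t)" .
    show "0 < E / D t" using E D[OF t] by simp
    show "f t \<in> borel_measurable lborel"
      unfolding f_def by measurable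
  qed (use q V1 in \<open>auto simp: f_def\<close>)
  have root: "(E / D t) powr (1 / q) = (E / c) powr (1 / q) * (t powr -(m / q) * max g t powr -((N - m) / q))"
    if t: "0 < t" for t
  proof -
    have "E / D t = (E / c) * (t powr -m * max g t powr -(N - m))"
      unfolding powr_minus using t g c powr_realpow[OF t, of "CARD('m)"]
      by (simp add: D_def m_def divide_simps)
    then have "(E / D t) powr (1 / q)
        = (E / c) powr (1 / q) * ((t powr -m) powr (1 / q) * (max g t powr -(N - m)) powr (1 / q))"
      using c E by (simp only: powr_mult)
    moreover have "-m * (1 / q) = -(m / q)" "-(N - m) * (1 / q) = -((N - m) / q)"
      by (simp_all add: diff_divide_distrib)
    ultimately show ?thesis by (simp only: powr_powr)
  qed
  \<comment> \<open>The cube of directions has volume one, so a constant equals its mean over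
    it.\<close>
  have "ennreal \<bar>u x\<bar> = (\<integral>\<^sup>+v. ennreal \<bar>u (lift blk a)\<bar> * indicator V v \<partial>lborel)"
    by (simp add: ua nn_integral_cmult V1)
  also have "\<dots> \<le> (\<integral>\<^sup>+v. (\<integral>\<^sup>+t. ennreal (M * f t v) * indicator {0..} t \<partial>lborel) * indicator V v \<partial>lborel)"
  proof (rule nn_integral_mono)
    fix v
    show "ennreal \<bar>u (lift blk a)\<bar> * indicator V v
        \<le> (\<integral>\<^sup>+t. ennreal (M * f t v) * indicator {0..} t \<partial>lborel) * indicator V v"
    proof (cases "v \<in> V")
      case True
      then show ?thesis
        using C1_line_integral_bound[OF bs C1, of R v a] R by (simp add: V_def M_def f_def)
    qed simp
  qed
  also have "\<dots> = (\<integral>\<^sup>+v. (\<integral>\<^sup>+t. ennreal (M * f t v) * indicator {0..} t * indicator V v \<partial>lborel) \<partial>lborel)"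
    unfolding f_def by (intro nn_integral_cong nn_integral_multc[symmetric]) measurable
  \<comment> \<open>The order is exchanged because the energy controls the mean over directions at a
    fixed \<open>t\<close>, not the integral along a fixed ray.\<close>
  also have "\<dots> = (\<integral>\<^sup>+t. (\<integral>\<^sup>+v. ennreal (M * f t v) * indicator {0..} t * indicator V v \<partial>lborel) \<partial>lborel)"
    unfolding f_def
    by (rule lborel_pair.Fubini'[where f="\<lambda>t v. ennreal (M * norm (grad u (lift blk (a + t *\<^sub>R v)))) * indicator {0..} t * indicator V v"]) measurable
  also have "\<dots> \<le> (\<integral>\<^sup>+t. ennreal (2 * M * (E / c) powr (1 / q)) *
      (ennreal (t powr -(m / q) * max g t powr -((N - m) / q)) * indicator {0..} t) \<partial>lborel)"
  \<comment> \<open>At \<open>t = 0\<close> the cube degenerates to a point and \<open>cube\<close>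
    gives nothing.\<close>
  proof (rule nn_integral_mono_AE, rule eventually_mono[OF AE_lborel_singleton[of 0]])
    fix t :: real assume "t \<noteq> 0"
    show "(\<integral>\<^sup>+v. ennreal (M * f t v) * indicator {0..} t * indicator V v \<partial>lborel)
      \<le> ennreal (2 * M * (E / c) powr (1 / q)) *
        (ennreal (t powr -(m / q) * max g t powr -((N - m) / q)) * indicator {0..} t)"
    proof (cases "0 < t")
      case True
      have "(\<integral>\<^sup>+v. ennreal (M * f t v) * indicator {0..} t * indicator V v \<partial>lborel)
          = (\<integral>\<^sup>+v. ennreal M * (ennreal (f t v) * indicator V v) \<partial>lborel)"
        using True M by (simp add: ennreal_mult' mult.assoc)
      also have "\<dots> = ennreal M * (\<integral>\<^sup>+v. ennreal (f t v) * indicator V v \<partial>lborel)"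
        unfolding f_def by (rule nn_integral_cmult) measurable
      also have "\<dots> \<le> ennreal M * ennreal (2 * (E / D t) powr (1 / q))"
        by (intro mult_left_mono cube[OF True]) simp
      also have "\<dots> = ennreal (2 * M * (E / c) powr (1 / q)) *
        (ennreal (t powr -(m / q) * max g t powr -((N - m) / q)) * indicator {0..} t)"
        using True M E c by (simp add: root ennreal_mult'[symmetric] mult_ac)
      finally show ?thesis .
    qed (use \<open>t \<noteq> 0\<close> in simp)
  qed
  also have "\<dots> = ennreal (2 * M * (E / c) powr (1 / q)) *
      ennreal (g powr (1 - m / q - (N - m) / q) * (1 / (1 - m / q) + 1 / (m / q + (N - m) / q - 1)))"
  proof -
    have "m / q + (N - m) / q = N / q" by (simp add: add_divide_distrib[symmetric])
    then have "(\<integral>\<^sup>+t. ennreal (t powr -(m / q) * max g t powr -((N - m) / q)) * indicator {0..} t \<partial>lborel)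
      = ennreal (g powr (1 - m / q - (N - m) / q) * (1 / (1 - m / q) + 1 / (m / q + (N - m) / q - 1)))"
      using q' g by (intro nn_integral_powr_max) auto
    then show ?thesis by (subst nn_integral_cmult) auto
  qed
  also have "\<dots> = ennreal (sup_const q \<gamma> blk * E powr (1 / q) * g powr (1 - N / q))"
  proof -
    have e: "1 - m / q - (N - m) / q = 1 - N / q" "m / q + (N - m) / q - 1 = N / q - 1"
      by (simp_all add: diff_divide_distrib)
    have E': "(E / c) powr (1 / q) = (1 / c) powr (1 / q) * E powr (1 / q)"
      using E c by (simp add: powr_divide)
    have S: "sup_const q \<gamma> blk = 2 * M * (1 / c) powr (1 / q) * (1 / (1 - m / q) + 1 / (N / q - 1))"
      by (simp add: sup_const_def M_def c_def m_def N_def)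
    show ?thesis
      unfolding e E' S using M by (simp add: ennreal_mult'[symmetric] mult_ac)
  qed
  finally have "\<bar>u x\<bar> \<le> sup_const q \<gamma> blk * E powr (1 / q) * g powr (1 - N / q)"
    using sup_const_pos[OF bs q] by (subst (asm) ennreal_le_iff) auto
  then have "\<bar>u x\<bar> powr q \<le> (sup_const q \<gamma> blk * E powr (1 / q) * g powr (1 - N / q)) powr q"
    using q by (intro powr_mono2) auto
  also have "\<dots> = sup_const q \<gamma> blk powr q * E * g powr (q - N)"
    using sup_const_pos[OF bs q] E g q' by (simp add: powr_mult powr_powr left_diff_distrib)
  finally have "g powr (N - q) * \<bar>u x\<bar> powr q \<le> g powr (N - q) * (sup_const q \<gamma> blk powr q * E * g powr (q - N))"
    by (rule mult_left_mono) simp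
  also have "\<dots> = sup_const q \<gamma> blk powr q * E * (g powr (N - q) * g powr (q - N))"
    by (simp only: mult_ac)
  also have "g powr (N - q) * g powr (q - N) = 1"
    using g by (simp add: powr_add[symmetric])
  finally show ?thesis
    by (simp only: g_def N_def mult_1_right)
qed

section \<open>The fundamental lemma of the calculus of variations\<close>


text \<open>The polynomial factor in \<open>1 / x\<close> makes the family containing the classical
  function \<open>exp (- (1 / x))\<close> closed under differentiation.\<close>

definition flat :: "real poly \<Rightarrow> real \<Rightarrow> real" where
  "flat p x = (if 0 < x then poly p (1 / x) * exp (- (1 / x)) else 0)"

lemma tendsto_poly_exp_minus: "((\<lambda>y. poly p y * exp (- y)) \<longlongrightarrow> (0::real)) at_top"
proof -
  have "((\<lambda>y. \<Sum>i\<le>degree p. coeff p i * (y ^ i / exp y)) \<longlongrightarrow> (\<Sum>i\<le>degree p. coeff p i * 0)) at_top"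
    by (intro tendsto_sum tendsto_mult tendsto_const tendsto_power_div_exp_0)
  then show ?thesis
    by (simp add: poly_altdef sum_distrib_right exp_minus divide_inverse mult.assoc)
qed

text \<open>With \<open>y = 1 / x\<close>, differentiating \<open>p(y) exp(-y)\<close> in
  \<open>x\<close> gives \<open>y^2 (p - p')(y) exp(-y)\<close>, which explains the polynomial. At 0
  the right difference quotient tends to 0 because the exponential beats every polynomial.\<close>

lemma flat_has_derivative:
  "(flat p has_real_derivative flat ([:0, 0, 1:] * (p - pderiv p)) x) (at x)"
proof -
  consider "0 < x" | "x < 0" | "x = 0" by linarith
  then show ?thesis
  proof cases
    case 1
    have "((\<lambda>x. poly p (1 / x) * exp (- (1 / x))) has_real_derivative
        flat ([:0, 0, 1:] * (p - pderiv p)) x) (at x)"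
    proof -
      have i: "((\<lambda>x. 1 / x) has_real_derivative - (1 / x\<^sup>2)) (at x)"
        using 1 by (auto intro!: derivative_eq_intros simp: power2_eq_square)
      have "((\<lambda>x. poly p (1 / x) * exp (- (1 / x))) has_real_derivative
          poly p (1 / x) * (exp (- (1 / x)) * - (- (1 / x\<^sup>2))) + (poly (pderiv p) (1 / x) * - (1 / x\<^sup>2)) * exp (- (1 / x))) (at x)"
        by (intro DERIV_mult' DERIV_chain2[OF poly_DERIV i] DERIV_chain2[OF DERIV_exp DERIV_minus[OF i]])
      then show ?thesis
        using 1 by (simp add: flat_def algebra_simps power2_eq_square)
    qed
    then show ?thesis
      by (rule has_field_derivative_transform_within_open[where S="{0<..}"]) (use 1 in \<open>auto simp: flat_def\<close>)
  next
    case 2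
    have "((\<lambda>x. 0) has_real_derivative 0) (at x)" by simp
    then have "(flat p has_real_derivative 0) (at x)"
      by (rule has_field_derivative_transform_within_open[where S="{..<0}"]) (use 2 in \<open>auto simp: flat_def\<close>)
    then show ?thesis using 2 by (simp add: flat_def)
  next
    case 3
    have "((\<lambda>h. flat p h / h) \<longlongrightarrow> 0) (at_left 0)"
      by (rule tendsto_eventually) (auto simp: flat_def eventually_at_filter)
    moreover have "((\<lambda>h. flat p h / h) \<longlongrightarrow> 0) (at_right 0)"
    proof -
      have "filterlim (\<lambda>h::real. 1 / h) at_top (at_right 0)"
        using filterlim_inverse_at_top_right by (simp add: inverse_eq_divide)
      from filterlim_compose[OF tendsto_poly_exp_minus[of "[:0, 1:] * p"] this]
      have "((\<lambda>h. (1 / h) * poly p (1 / h) * exp (- (1 / h))) \<longlongrightarrow> 0) (at_right 0)"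
        by simp
      then show ?thesis
        by (rule Lim_transform_eventually) (auto simp: flat_def eventually_at_filter)
    qed
    ultimately have "((\<lambda>h. flat p h / h) \<longlongrightarrow> 0) (at 0)"
      by (rule filterlim_split_at)
    then show ?thesis
      using 3 by (simp add: has_field_derivative_iff flat_def)
  qed
qed

text \<open>An algebra of functions generated by \<open>flat\<close> and closed under partial derivatives, which makes
  smoothness of its members an induction.\<close>

inductive flat_algebra :: "(real^'n::finite \<Rightarrow> real) \<Rightarrow> bool" where
  const: "flat_algebra (\<lambda>x. c)"
| flat: "flat_algebra (\<lambda>x. flat p (\<alpha> * x $ i + \<beta>))"
| add: "flat_algebra f \<Longrightarrow> flat_algebra g \<Longrightarrow> flat_algebra (\<lambda>x. f x + g x)"
| mult: "flat_algebra f \<Longrightarrow> flat_algebra g \<Longrightarrow> flat_algebra (\<lambda>x. f x * g x)"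

lemma flat_algebra_partial:
  fixes f :: "real^'n::finite \<Rightarrow> real"
  assumes "flat_algebra f"
  shows "(\<forall>x. f differentiable at x) \<and> (\<forall>i. flat_algebra (partial i f))"
  using assms
proof induction
  case (const c)
  have "partial i (\<lambda>x::real^'n. c) = (\<lambda>x. 0)" for i
    by (rule ext, subst partial_eqI[OF has_derivative_const]) simp
  then show ?case by (simp add: flat_algebra.const)
next
  case (flat p \<alpha> j \<beta>)
  have D: "((\<lambda>x::real^'n. flat p (\<alpha> * x $ j + \<beta>)) has_derivative
      (\<lambda>h. flat ([:0, 0, 1:] * (p - pderiv p)) (\<alpha> * x $ j + \<beta>) * (\<alpha> * h $ j))) (at x)" for x
  proof -
    have 1: "((\<lambda>x::real^'n. \<alpha> * x $ j + \<beta>) has_derivative (\<lambda>h. \<alpha> * h $ j)) (at x)"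
      by (auto intro!: derivative_eq_intros bounded_linear.has_derivative[OF bounded_linear_vec_nth])
    show ?thesis
      by (rule has_derivative_compose[OF 1 flat_has_derivative[unfolded has_field_derivative_def]])
  qed
  have "partial i (\<lambda>x::real^'n. flat p (\<alpha> * x $ j + \<beta>)) =
      (\<lambda>x. flat ([:0, 0, 1:] * (p - pderiv p)) (\<alpha> * x $ j + \<beta>) * (\<alpha> * axis i 1 $ j))" for i
    using partial_eqI[OF D] by blast
  then show ?case
    using D unfolding differentiable_def by (auto simp only: intro!: flat_algebra.intros)
next
  case (add f g)
  have D: "((\<lambda>x. f x + g x) has_derivative (\<lambda>h. (grad f x \<bullet> h) + (grad g x \<bullet> h))) (at x)" for x
    using add.IH by (intro has_derivative_add differentiable_has_derivative_grad) auto
  have "partial i (\<lambda>x. f x + g x) = (\<lambda>x. partial i f x + partial i g x)" for i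
    using partial_eqI[OF D] by (simp add: fun_eq_iff inner_axis grad_def)
  then show ?case
    using D add.IH unfolding differentiable_def by (auto intro!: flat_algebra.intros)
next
  case (mult f g)
  have D: "((\<lambda>x. f x * g x) has_derivative (\<lambda>h. f x * (grad g x \<bullet> h) + (grad f x \<bullet> h) * g x)) (at x)" for x
    using mult.IH by (intro has_derivative_mult differentiable_has_derivative_grad) auto
  have "partial i (\<lambda>x. f x * g x) = (\<lambda>x. f x * partial i g x + partial i f x * g x)" for i
    using partial_eqI[OF D] by (simp add: fun_eq_iff inner_axis grad_def)
  then show ?case
    using D mult.IH mult.hyps unfolding differentiable_def by (auto intro!: flat_algebra.intros)
qed

lemma smooth_flat_algebra:
  assumes "flat_algebra f"
  shows "smooth f"
  unfolding smooth_def
proof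
  fix k
  show "C_k k f"
    using assms
  proof (induction k arbitrary: f)
    case 0
    then show ?case
      using flat_algebra_partial[OF 0] by (auto intro!: continuous_at_imp_continuous_on differentiable_imp_continuous_within)
  next
    case (Suc k)
    then show ?case using flat_algebra_partial[OF Suc.prems] by simp
  qed
qed

lemma flat_algebra_prod:
  assumes "finite I" "\<And>i. i \<in> I \<Longrightarrow> flat_algebra (f i)"
  shows "flat_algebra (\<lambda>x. \<Prod>i\<in>I. f i x)"
  using assms by (induction I rule: finite_induct) (auto intro: flat_algebra.intros)

text \<open>As \<open>k\<close> grows the flanks steepen while the set where the function is
  positive remains the open box. This gives bounded smooth approximations of the box indicator
  without any convolution.\<close>

definition box_bump :: "real^'n::finite \<Rightarrow> real^'n \<Rightarrow> nat \<Rightarrow> real^'n \<Rightarrow> real" where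
  "box_bump a b k x = (\<Prod>i\<in>UNIV. flat 1 (real (Suc k) * (x $ i - a $ i)) * flat 1 (real (Suc k) * (b $ i - x $ i)))"

lemma flat_1: "0 \<le> flat 1 x" "flat 1 x \<le> 1" "flat 1 x = 0 \<longleftrightarrow> x \<le> 0"
  by (auto simp: flat_def)

lemma box_bump_nonzero_imp: "box_bump a b k x \<noteq> 0 \<Longrightarrow> x \<in> box a b"
  by (auto simp: box_bump_def mem_box_cart flat_1 zero_less_mult_iff mult_le_0_iff not_le)

lemma box_bump_bounds: "0 \<le> box_bump a b k x" "box_bump a b k x \<le> 1"
  unfolding box_bump_def by (auto intro!: prod_nonneg prod_le_1 mult_nonneg_nonneg mult_le_one flat_1)

lemma box_bump_test_function: "box_bump a b k \<in> test_functions UNIV"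
proof -
  have "flat_algebra (\<lambda>x. flat 1 (real (Suc k) * (x $ i - a $ i)) * flat 1 (real (Suc k) * (b $ i - x $ i)))" for i
  proof (rule flat_algebra.mult)
    have "(\<lambda>x. flat 1 (real (Suc k) * (x $ i - a $ i))) = (\<lambda>x. flat 1 (real (Suc k) * x $ i + - real (Suc k) * a $ i))"
      by (simp add: algebra_simps)
    then show "flat_algebra (\<lambda>x. flat 1 (real (Suc k) * (x $ i - a $ i)))"
      by (simp only: flat_algebra.flat)
    have "(\<lambda>x. flat 1 (real (Suc k) * (b $ i - x $ i))) = (\<lambda>x. flat 1 (- real (Suc k) * x $ i + real (Suc k) * b $ i))"
      by (simp add: algebra_simps)
    then show "flat_algebra (\<lambda>x. flat 1 (real (Suc k) * (b $ i - x $ i)))"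
      by (simp only: flat_algebra.flat)
  qed
  then have "smooth (box_bump a b k)"
    unfolding box_bump_def[abs_def] by (intro smooth_flat_algebra flat_algebra_prod) auto
  moreover have "closure {x. box_bump a b k x \<noteq> 0} \<subseteq> cbox a b"
    using box_bump_nonzero_imp[of a b k] box_subset_cbox[of a b] by (intro closure_minimal closed_cbox) blast
  then have "compact (closure {x. box_bump a b k x \<noteq> 0})"
    by (meson bounded_cbox bounded_subset closed_closure compact_eq_bounded_closed)
  ultimately show ?thesis by (simp add: test_functions_def)
qed

lemma flat_1_tendsto: "(\<lambda>k. flat 1 (real (Suc k) * y)) \<longlonglongrightarrow> indicat_real {0<..} y"
proof (cases "0 < y")
  case True
  have "(\<lambda>k. exp (- (inverse (real (Suc k)) / y))) \<longlonglongrightarrow> exp (- (0 / y))"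
    by (intro tendsto_intros LIMSEQ_inverse_real_of_nat) (use True in auto)
  then show ?thesis using True by (simp add: flat_def inverse_eq_divide del: of_nat_Suc)
qed (simp add: flat_def mult_le_0_iff zero_less_mult_iff)

lemma box_bump_tendsto: "(\<lambda>k. box_bump a b k x) \<longlonglongrightarrow> indicat_real (box a b) x"
proof -
  have "(\<lambda>k. box_bump a b k x) \<longlonglongrightarrow> (\<Prod>i\<in>UNIV. indicat_real {0<..} (x $ i - a $ i) * indicat_real {0<..} (b $ i - x $ i))"
    unfolding box_bump_def by (intro tendsto_prod tendsto_mult flat_1_tendsto)
  also have "(\<Prod>i\<in>UNIV. indicat_real {0<..} (x $ i - a $ i) * indicat_real {0<..} (b $ i - x $ i)) = indicat_real (box a b) x"
    by (auto simp: indicator_def mem_box_cart)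
  finally show ?thesis .
qed

text \<open>Since \<open>ennreal\<close> truncates negative numbers to 0, \<open>?M\<close> and
  \<open>?N\<close> have the positive and the negative part of \<open>g\<close> as densities. They
  agree on boxes, an intersection-stable generator, so the densities agree almost
  everywhere.\<close>

lemma AE_eq_0_if_integral_box:
  fixes g :: "'a::euclidean_space \<Rightarrow> real"
  assumes g: "integrable lborel g" and 0: "\<And>a b. (LINT x|lborel. g x * indicator (box a b) x) = 0"
  shows "AE x in lborel. g x = 0"
proof -
  have [measurable]: "g \<in> borel_measurable borel"
    using borel_measurable_integrable[OF g] by simp
  let ?M = "density lborel (\<lambda>x. ennreal (g x))" and ?N = "density lborel (\<lambda>x. ennreal (- g x))"
  have fin: "(\<integral>\<^sup>+x. ennreal (g x) \<partial>lborel) \<noteq> \<infinity>" "(\<integral>\<^sup>+x. ennreal (- g x) \<partial>lborel) \<noteq> \<infinity>"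
    using g by (auto simp: real_integrable_def)
  \<comment> \<open>\<open>enn2real\<close> maps infinity to 0, so it can be cancelled only between
    finite values.\<close>
  have enn: "x = y" if "enn2real x = enn2real y" "x \<noteq> \<infinity>" "y \<noteq> \<infinity>" for x y :: ennreal
    using that by (cases x; cases y) auto
  have eq: "emeasure ?M (box a b) = emeasure ?N (box a b)" for a b
  proof -
    let ?f = "\<lambda>x. g x * indicator (box a b) x"
    have f: "integrable lborel ?f"
      using integrable_mult_indicator[OF _ g, of "box a b"] by (simp add: mult.commute)
    have "enn2real (\<integral>\<^sup>+x. ennreal (?f x) \<partial>lborel) = enn2real (\<integral>\<^sup>+x. ennreal (- ?f x) \<partial>lborel)"
      using real_lebesgue_integral_def[OF f] 0[of a b] by simp
    moreover have "(\<integral>\<^sup>+x. ennreal (?f x) \<partial>lborel) \<noteq> \<infinity>" "(\<integral>\<^sup>+x. ennreal (- ?f x) \<partial>lborel) \<noteq> \<infinity>"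
      using f by (auto simp: real_integrable_def)
    ultimately have "(\<integral>\<^sup>+x. ennreal (?f x) \<partial>lborel) = (\<integral>\<^sup>+x. ennreal (- ?f x) \<partial>lborel)"
      by (rule enn)
    moreover have "ennreal (?f x) = ennreal (g x) * indicator (box a b) x"
      "ennreal (- ?f x) = ennreal (- g x) * indicator (box a b) x" for x
      by (auto split: split_indicator)
    ultimately show ?thesis
      by (simp add: emeasure_density)
  qed
  have "?M = ?N"
  proof (rule measure_eqI_generator_eq[where \<Omega>=UNIV and E="range (\<lambda>(a, b). box a b)"
        and A="\<lambda>n. box (- (real n *\<^sub>R One)) (real n *\<^sub>R One)"])
    show "Int_stable (range (\<lambda>(a, b). box a b :: 'a set))"
      by (auto simp: Int_stable_def box_Int_box)
    show "emeasure ?M X = emeasure ?N X" if "X \<in> range (\<lambda>(a, b). box a b)" for X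
      using that eq by auto
    show "sets ?M = sigma_sets UNIV (range (\<lambda>(a, b). box a b))"
      "sets ?N = sigma_sets UNIV (range (\<lambda>(a, b). box a b))"
      by (simp_all add: borel_eq_box)
    show "(\<Union>i. box (- (real i *\<^sub>R One)) (real i *\<^sub>R One)) = (UNIV :: 'a set)"
      by (rule UN_box_eq_UNIV)
    fix i
    have "emeasure ?M (box (- (real i *\<^sub>R One)) (real i *\<^sub>R One)) \<le> emeasure ?M (space ?M)"
      by (rule emeasure_space)
    also have "\<dots> = (\<integral>\<^sup>+x. ennreal (g x) \<partial>lborel)"
      by (simp add: emeasure_density)
    finally show "emeasure ?M (box (- (real i *\<^sub>R One)) (real i *\<^sub>R One)) \<noteq> \<infinity>"
      using fin(1) by (metis neq_top_trans infinity_ennreal_def)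
  qed auto
  then have "AE x in lborel. ennreal (g x) = ennreal (- g x)"
    using fin by (subst finite_density_unique[symmetric]) auto
  then show ?thesis
  proof eventually_elim
    case (elim x)
    then show ?case
      by (cases "0 \<le> g x") (auto simp: ennreal_neg)
  qed
qed


section \<open>Locally integrable functions tested against smooth ones\<close>

lemma locally_integrableD:
  assumes "locally_integrable f" "compact K"
  shows "integrable lebesgue (\<lambda>x. indicat_real K x *\<^sub>R f x)"
  using assms by (simp add: locally_integrable_def set_integrable_def)

lemma locally_integrable_measurable:
  assumes "locally_integrable f"
  shows "f \<in> borel_measurable lebesgue"
proof (rule borel_measurable_LIMSEQ_real)
  show "(\<lambda>n. indicat_real (cball 0 (real n)) x * f x) \<longlonglongrightarrow> f x" for x
  proof (rule tendsto_eventually, rule eventually_sequentiallyI)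
    fix n assume "nat \<lceil>norm x\<rceil> \<le> n"
    then have "norm x \<le> real n" by linarith
    then show "indicat_real (cball 0 (real n)) x * f x = f x" by simp
  qed
  show "(\<lambda>x. indicat_real (cball 0 (real n)) x * f x) \<in> borel_measurable lebesgue" for n
    using borel_measurable_integrable[OF locally_integrableD[OF assms compact_cball]] by simp
qed

lemma locally_integrable_mult_bounded:
  assumes f: "locally_integrable f" and K: "compact K"
    and [measurable]: "\<phi> \<in> borel_measurable borel" and b: "\<And>x. \<bar>\<phi> x\<bar> \<le> B" and 0: "\<And>x. x \<notin> K \<Longrightarrow> \<phi> x = 0"
  shows "integrable lebesgue (\<lambda>x. f x * \<phi> x)"
proof (rule Bochner_Integration.integrable_bound)
  show "integrable lebesgue (\<lambda>x. B * \<bar>indicat_real K x *\<^sub>R f x\<bar>)"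
    by (intro integrable_mult_right integrable_abs locally_integrableD f K)
  have "\<phi> \<in> borel_measurable lebesgue" by (rule measurable_completion) simp
  then show "(\<lambda>x. f x * \<phi> x) \<in> borel_measurable lebesgue"
    using locally_integrable_measurable[OF f] by (rule borel_measurable_times[rotated])
  show "AE x in lebesgue. norm (f x * \<phi> x) \<le> norm (B * \<bar>indicat_real K x *\<^sub>R f x\<bar>)"
  proof (rule AE_I2)
    fix x
    have "0 \<le> B" using b[of x] by linarith
    then show "norm (f x * \<phi> x) \<le> norm (B * \<bar>indicat_real K x *\<^sub>R f x\<bar>)"
      using b[of x] 0[of x] by (cases "x \<in> K") (auto simp: abs_mult mult.commute intro: mult_right_mono)
  qed
qed

lemma test_function_C1:
  assumes "\<phi> \<in> test_functions \<Omega>"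
  shows "C_k (Suc 0) \<phi>" and "\<exists>R. \<forall>x. R < norm x \<longrightarrow> \<phi> x = 0"
proof -
  show "C_k (Suc 0) \<phi>"
    using assms unfolding test_functions_def smooth_def by blast
  have "bounded {x. \<phi> x \<noteq> 0}"
    using assms by (metis (mono_tags, lifting) bounded_subset closure_subset compact_imp_bounded mem_Collect_eq test_functions_def)
  then show "\<exists>R. \<forall>x. R < norm x \<longrightarrow> \<phi> x = 0"
    unfolding bounded_iff by (metis (mono_tags, lifting) mem_Collect_eq not_le)
qed

text \<open>Testing with \<open>box_bump\<close> and passing to the limit shows that all box
  integrals vanish. The measure argument then needs an integrable function, so \<open>f\<close> is
  cut off to boxes that exhaust the space.\<close>

lemma du_Bois_Reymond:
  fixes f :: "real^'n::finite \<Rightarrow> real"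
  assumes f: "locally_integrable f"
    and 0: "\<And>\<phi>. \<phi> \<in> test_functions UNIV \<Longrightarrow> (LINT x|lebesgue. f x * \<phi> x) = 0"
  shows "AE x in lebesgue. f x = 0"
proof -
  have bump: "box_bump a b k \<in> borel_measurable borel" for a b :: "real^'n" and k
    by (intro borel_measurable_continuous_onI C1_continuous test_function_C1(1)[OF box_bump_test_function])
  have m: "f \<in> borel_measurable lebesgue"
    by (rule locally_integrable_measurable[OF f])
  have box0: "(LINT x|lebesgue. f x * indicator (box a b) x) = 0" for a b
  proof -
    have "(\<lambda>k. LINT x|lebesgue. f x * box_bump a b k x) \<longlonglongrightarrow> (LINT x|lebesgue. f x * indicator (box a b) x)"
    proof (rule integral_dominated_convergence[where w="\<lambda>x. \<bar>indicat_real (cbox a b) x *\<^sub>R f x\<bar>"])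
      show "(\<lambda>x. f x * indicator (box a b) x) \<in> borel_measurable lebesgue"
        by (intro borel_measurable_times m borel_measurable_indicator) auto
      show "(\<lambda>x. f x * box_bump a b k x) \<in> borel_measurable lebesgue" for k
        using measurable_completion[of "box_bump a b k" lborel] bump by (intro borel_measurable_times m) auto
      show "integrable lebesgue (\<lambda>x. \<bar>indicat_real (cbox a b) x *\<^sub>R f x\<bar>)"
        by (intro integrable_abs locally_integrableD f) simp
      show "AE x in lebesgue. norm (f x * box_bump a b k x) \<le> \<bar>indicat_real (cbox a b) x *\<^sub>R f x\<bar>" for k
      proof (rule AE_I2)
        fix x
        show "norm (f x * box_bump a b k x) \<le> \<bar>indicat_real (cbox a b) x *\<^sub>R f x\<bar>"
          using box_bump_bounds[of a b k x] box_bump_nonzero_imp[of a b k x] box_subset_cbox[of a b]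
          by (cases "box_bump a b k x = 0") (auto simp: abs_mult mult_left_le)
      qed
      show "AE x in lebesgue. (\<lambda>k. f x * box_bump a b k x) \<longlonglongrightarrow> f x * indicator (box a b) x"
        by (intro AE_I2 tendsto_mult tendsto_const box_bump_tendsto)
    qed
    moreover have "(LINT x|lebesgue. f x * box_bump a b k x) = 0" for k
      by (rule 0[OF box_bump_test_function])
    ultimately show ?thesis by (simp add: LIMSEQ_const_iff)
  qed
  have "AE x in lebesgue. \<forall>n. f x * indicator (box (- (real n *\<^sub>R One)) (real n *\<^sub>R One)) x = 0"
  proof (subst AE_all_countable, intro allI)
    fix n
    let ?B = "box (- (real n *\<^sub>R One)) (real n *\<^sub>R One) :: (real^'n) set"
    let ?g = "\<lambda>x. f x * indicat_real ?B x"
    have gi: "integrable lebesgue ?g"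
      by (rule locally_integrable_mult_bounded[OF f, of "cbox (- (real n *\<^sub>R One)) (real n *\<^sub>R One)" _ 1])
        (use box_subset_cbox in \<open>auto simp: indicator_def\<close>)
    \<comment> \<open>The uniqueness lemma for box integrals concerns \<open>lborel\<close>, so the
      Lebesgue measurable cut-off is replaced by a Borel representative.\<close>
    then obtain g' where g': "g' \<in> borel_measurable lborel" "AE x in lborel. ?g x = g' x"
      using completion_ex_borel_measurable_real[OF borel_measurable_integrable[OF gi]] by blast
    have g'l: "g' \<in> borel_measurable lebesgue" by (rule measurable_completion[OF g'(1)])
    have ae: "AE x in lebesgue. ?g x = g' x" by (rule AE_completion[OF g'(2)])
    have "integrable lebesgue g'"
      using gi by (rule integrable_cong_AE_imp) (use g'l ae in auto)
    then have g'i: "integrable lborel g'"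
      using g'(1) by (simp add: integrable_completion)
    have "AE x in lborel. g' x = 0"
    proof (rule AE_eq_0_if_integral_box[OF g'i])
      fix a b :: "real^'n"
      \<comment> \<open>The intersection of two boxes is a box, so the cut-off is absorbed into the
        box of integration.\<close>
      obtain c d where cd: "?B \<inter> box a b = box c d"
        unfolding box_Int_box by blast
      have "(LINT x|lborel. g' x * indicator (box a b) x) = (LINT x|lebesgue. g' x * indicator (box a b) x)"
        using g'(1) by (intro integral_completion[symmetric]) auto
      also have "\<dots> = (LINT x|lebesgue. f x * indicator (box c d) x)"
      proof (rule integral_cong_AE)
        show "AE x in lebesgue. g' x * indicator (box a b) x = f x * indicator (box c d) x"
          using ae by eventually_elim (auto simp: cd[symmetric] indicator_inter_arith mult.assoc[symmetric])
      qed (intro borel_measurable_times borel_measurable_indicator g'l m, auto)+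
      finally show "(LINT x|lborel. g' x * indicator (box a b) x) = 0"
        by (simp add: box0)
    qed
    then have "AE x in lebesgue. g' x = 0" by (rule AE_completion)
    then show "AE x in lebesgue. ?g x = 0"
      using ae by eventually_elim simp
  qed
  then show ?thesis
  proof eventually_elim
    case (elim x)
    have "x \<in> (\<Union>n. box (- (real n *\<^sub>R One)) (real n *\<^sub>R One))"
      by (simp add: UN_box_eq_UNIV)
    then obtain n where "x \<in> box (- (real n *\<^sub>R One)) (real n *\<^sub>R One)" by blast
    then show ?case using elim[rule_format, of n] by simp
  qed
qed

section \<open>Limits of gradients in \<open>L\<^sup>q\<close>\<close>


text \<open>The Riesz-Fischer theorem: a rapidly converging subsequence converges almost everywhere,
  and Fatou's lemma along it yields convergence of the whole sequence. Integrals of q-th powers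
  replace norms, so Minkowski's inequality does not enter.\<close>

lemma Cauchy_Lq_limit:
  fixes F :: "nat \<Rightarrow> 'a \<Rightarrow> 'b::euclidean_space"
  assumes [measurable]: "\<And>k. F k \<in> borel_measurable M" and q: "0 < q"
    and Cauchy: "\<And>e. 0 < e \<Longrightarrow> \<exists>N. \<forall>k\<ge>N. \<forall>l\<ge>N. (\<integral>\<^sup>+x. ennreal (norm (F k x - F l x) powr q) \<partial>M) \<le> ennreal e"
  obtains G where "G \<in> borel_measurable M"
    "\<And>e. 0 < e \<Longrightarrow> \<exists>N. \<forall>k\<ge>N. (\<integral>\<^sup>+x. ennreal (norm (F k x - G x) powr q) \<partial>M) \<le> ennreal e"
proof -
  define I where "I k l = (\<integral>\<^sup>+x. ennreal (norm (F k x - F l x) powr q) \<partial>M)" for k l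
  \<comment> \<open>The factor \<open>(2 ^ k) powr q\<close> is cancelled in \<open>d\<close>,
    leaving integrals bounded by a geometric series. Then \<open>d k x\<close> tends to 0 almost
    everywhere, which forces consecutive differences below \<open>(1 / 2) ^ k\<close>
    eventually.\<close>
  define b :: "nat \<Rightarrow> real" where "b k = (1 / 2) ^ k / (2 ^ k) powr q" for k
  have b: "0 < b k" for k by (simp add: b_def)
  obtain N where N: "\<And>k i j. N k \<le> i \<Longrightarrow> N k \<le> j \<Longrightarrow> I i j \<le> ennreal (b k)"
    using Cauchy[OF b] unfolding I_def by metis
  \<comment> \<open>The sum makes \<open>r\<close> nondecreasing and at least \<open>N k\<close>;
    the summand \<open>k\<close> makes it unbounded.\<close>
  define r where "r k = (\<Sum>i\<le>k. N i) + k" for k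
  have r: "N k \<le> r k" "r k \<le> r (Suc k)" "k \<le> r k" for k
    using member_le_sum[of k "{..k}" N] by (auto simp: r_def)
  define d where "d k x = (2 ^ k * norm (F (r (Suc k)) x - F (r k) x)) powr q" for k x
  have dint: "(\<integral>\<^sup>+x. ennreal (d k x) \<partial>M) \<le> ennreal ((1 / 2) ^ k)" for k
  proof -
    have "(\<integral>\<^sup>+x. ennreal (d k x) \<partial>M) = ennreal ((2 ^ k) powr q) * I (r (Suc k)) (r k)"
      unfolding I_def d_def by (subst nn_integral_cmult[symmetric]) (auto simp: powr_mult ennreal_mult')
    also have "\<dots> \<le> ennreal ((2 ^ k) powr q) * ennreal (b k)"
      using r[of k] by (intro mult_left_mono N) auto
    also have "\<dots> = ennreal ((1 / 2) ^ k)"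
      by (simp add: ennreal_mult'[symmetric] b_def)
    finally show ?thesis .
  qed
  have "(\<integral>\<^sup>+x. (\<Sum>k. ennreal (d k x)) \<partial>M) = (\<Sum>k. \<integral>\<^sup>+x. ennreal (d k x) \<partial>M)"
    unfolding d_def by (intro nn_integral_suminf) measurable
  also have "\<dots> \<le> (\<Sum>k. ennreal ((1 / 2) ^ k))"
    by (intro suminf_le dint summableI)
  also have "\<dots> = ennreal (\<Sum>k. (1 / 2) ^ k)"
    by (intro suminf_ennreal2 summable_geometric) auto
  finally have "(\<integral>\<^sup>+x. (\<Sum>k. ennreal (d k x)) \<partial>M) < top"
    by (rule le_less_trans) simp
  then have "(\<integral>\<^sup>+x. (\<Sum>k. ennreal (d k x)) \<partial>M) \<noteq> \<infinity>"
    by simp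
  then have "AE x in M. (\<Sum>k. ennreal (d k x)) \<noteq> \<infinity>"
    unfolding d_def by (intro nn_integral_noteq_infinite) auto
  then have conv: "AE x in M. convergent (\<lambda>k. F (r k) x)"
  proof eventually_elim
    case (elim x)
    have "summable (\<lambda>k. d k x)"
      using elim by (intro summable_suminf_not_top) (auto simp: d_def)
    then have "(\<lambda>k. d k x) \<longlonglongrightarrow> 0"
      by (rule summable_LIMSEQ_zero)
    then have "\<forall>\<^sub>F k in sequentially. d k x < 1"
      by (rule order_tendstoD) simp
    then have "\<forall>\<^sub>F k in sequentially. norm (F (r (Suc k)) x - F (r k) x) \<le> (1 / 2) ^ k"
    proof eventually_elim
      case (elim k)
      have "2 ^ k * norm (F (r (Suc k)) x - F (r k) x) < 1"
      proof (rule ccontr)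
        assume "\<not> ?thesis"
        then have "1 \<le> d k x" using q unfolding d_def by (intro ge_one_powr_ge_zero) auto
        then show False using elim by simp
      qed
      then show ?case by (simp add: field_simps)
    qed
    then have "summable (\<lambda>k. F (r (Suc k)) x - F (r k) x)"
      by (rule summable_comparison_test_ev) (auto intro: summable_geometric)
    then have "convergent (\<lambda>n. F (r 0) x + (\<Sum>k<n. F (r (Suc k)) x - F (r k) x))"
      by (intro convergent_add convergent_const) (simp add: summable_iff_convergent)
    then show ?case
      using sum_lessThan_telescope[of "\<lambda>k. F (r k) x"] by simp
  qed
  define G where "G x = lim (\<lambda>k. F (r k) x)" for x
  have [measurable]: "G \<in> borel_measurable M"
    unfolding G_def by measurable
  show thesis
  proof (rule that)
    fix e :: real assume "0 < e"
    then obtain N where N: "\<And>k l. N \<le> k \<Longrightarrow> N \<le> l \<Longrightarrow> I k l \<le> ennreal e"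
      using Cauchy unfolding I_def by meson
    have "(\<integral>\<^sup>+x. ennreal (norm (F k x - G x) powr q) \<partial>M) \<le> ennreal e" if "N \<le> k" for k
    proof -
      have "(\<integral>\<^sup>+x. ennreal (norm (F k x - G x) powr q) \<partial>M)
          = (\<integral>\<^sup>+x. liminf (\<lambda>l. ennreal (norm (F k x - F (r l) x) powr q)) \<partial>M)"
      proof (rule nn_integral_cong_AE)
        show "AE x in M. ennreal (norm (F k x - G x) powr q) = liminf (\<lambda>l. ennreal (norm (F k x - F (r l) x) powr q))"
          using conv
        proof eventually_elim
          case (elim x)
          then have "(\<lambda>l. F (r l) x) \<longlonglongrightarrow> G x"
            by (simp add: G_def convergent_LIMSEQ_iff)
          then have "(\<lambda>l. ennreal (norm (F k x - F (r l) x) powr q)) \<longlonglongrightarrow> ennreal (norm (F k x - G x) powr q)"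
            using q by (intro tendsto_ennrealI tendsto_powr' tendsto_norm tendsto_diff tendsto_const) auto
          then show ?case
            by (intro lim_imp_Liminf[symmetric]) simp_all
        qed
      qed
      also have "\<dots> \<le> liminf (\<lambda>l. I k (r l))"
        unfolding I_def by (rule nn_integral_liminf) measurable
      also have "\<dots> \<le> ennreal e"
      proof (rule Liminf_le)
        show "\<forall>\<^sub>F l in sequentially. I k (r l) \<le> ennreal e"
          using N[OF that] r(3) by (intro eventually_sequentiallyI[of N]) (meson order_trans)
      qed simp
      finally show ?thesis .
    qed
    then show "\<exists>N. \<forall>k\<ge>N. (\<integral>\<^sup>+x. ennreal (norm (F k x - G x) powr q) \<partial>M) \<le> ennreal e" by blast
  qed fact
qed

text \<open>Takes the place of Minkowski's inequality when gradients are compared with their limit;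
  it is the origin of the factor 2 in the final constant.\<close>

lemma norm_powr_le_2_powr:
  fixes a b :: "'a::real_normed_vector"
  assumes "0 \<le> q"
  shows "norm a powr q \<le> 2 powr q * (norm (a - b) powr q + norm b powr q)"
proof -
  have "norm a \<le> norm (a - b) + norm b"
    using norm_triangle_ineq[of "a - b" b] by simp
  also have "\<dots> \<le> 2 * max (norm (a - b)) (norm b)" by simp
  finally have "norm a powr q \<le> (2 * max (norm (a - b)) (norm b)) powr q"
    using assms by (intro powr_mono2) auto
  also have "\<dots> \<le> 2 powr q * (norm (a - b) powr q + norm b powr q)"
    by (auto simp: powr_mult max_def)
  finally show ?thesis .
qed

lemma nn_integral_norm_powr_le:
  fixes f g :: "'a \<Rightarrow> 'b::euclidean_space"
  assumes [measurable]: "f \<in> borel_measurable M" "g \<in> borel_measurable M" and q: "0 \<le> q"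
  shows "(\<integral>\<^sup>+x. ennreal (norm (f x) powr q) \<partial>M) \<le> ennreal (2 powr q) *
    ((\<integral>\<^sup>+x. ennreal (norm (f x - g x) powr q) \<partial>M) + (\<integral>\<^sup>+x. ennreal (norm (g x) powr q) \<partial>M))"
proof -
  have "(\<integral>\<^sup>+x. ennreal (norm (f x) powr q) \<partial>M)
      \<le> (\<integral>\<^sup>+x. ennreal (2 powr q) * (ennreal (norm (f x - g x) powr q) + ennreal (norm (g x) powr q)) \<partial>M)"
    by (intro nn_integral_mono)
      (simp add: ennreal_mult'[symmetric] ennreal_plus[symmetric] norm_powr_le_2_powr q ennreal_leI del: ennreal_plus)
  then show ?thesis
    by (simp add: nn_integral_cmult nn_integral_add)
qed


section \<open>Passage to the limit in weak gradients, and their uniqueness\<close>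

lemma locally_integrable_continuous:
  fixes f :: "real^'n::finite \<Rightarrow> real"
  assumes "continuous_on UNIV f"
  shows "locally_integrable f"
  unfolding locally_integrable_def set_integrable_def
proof (intro allI impI)
  fix K :: "(real^'n) set" assume K: "compact K"
  have c: "continuous_on K f" using assms by (rule continuous_on_subset) simp
  have "integrable lborel (\<lambda>x. indicat_real K x *\<^sub>R f x)"
    by (rule borel_integrable_compact[OF K c])
  then show "integrable lebesgue (\<lambda>x. indicat_real K x *\<^sub>R f x)"
    using borel_measurable_integrable integrable_completion by blast
qed

lemma L1_loc_pairing_tendsto:
  fixes f :: "real^'n::finite \<Rightarrow> real" and fs :: "nat \<Rightarrow> real^'n \<Rightarrow> real"
  assumes f: "locally_integrable f" and fs: "\<And>k. locally_integrable (fs k)"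
    and lim: "\<And>K. compact K \<Longrightarrow> (\<lambda>k. LINT x:K|lebesgue. \<bar>fs k x - f x\<bar>) \<longlonglongrightarrow> 0"
    and c: "continuous_on UNIV \<psi>" and R: "\<And>x. R < norm x \<Longrightarrow> \<psi> x = 0"
  shows "(\<lambda>k. LINT x|lebesgue. fs k x * \<psi> x) \<longlonglongrightarrow> (LINT x|lebesgue. f x * \<psi> x)"
proof -
  let ?K = "cball 0 R :: (real^'n) set"
  have "compact (\<psi> ` ?K)"
    by (intro compact_continuous_image continuous_on_subset[OF c]) auto
  then obtain B where B: "\<And>x. x \<in> ?K \<Longrightarrow> \<bar>\<psi> x\<bar> \<le> B"
    by (force dest!: compact_imp_bounded simp: bounded_iff)
  define B' where "B' = max B 0"
  have B': "\<bar>\<psi> x\<bar> \<le> B' * indicat_real ?K x" for x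
    using B[of x] R[of x] by (cases "x \<in> ?K") (auto simp: B'_def not_le)
  have B'1: "\<bar>\<psi> x\<bar> \<le> B'" for x
    using B'[of x] by (cases "x \<in> ?K") (auto simp: B'_def)
  have \<psi>0: "\<psi> x = 0" if "x \<notin> ?K" for x
    using that R by simp
  have m: "\<psi> \<in> borel_measurable borel"
    by (rule borel_measurable_continuous_onI[OF c])
  have int: "integrable lebesgue (\<lambda>x. h x * \<psi> x)" if "locally_integrable h" for h
    by (rule locally_integrable_mult_bounded[OF that compact_cball[of 0 R] m B'1 \<psi>0])
  have bound: "\<bar>(LINT x|lebesgue. fs k x * \<psi> x) - (LINT x|lebesgue. f x * \<psi> x)\<bar>
      \<le> B' * (LINT x:?K|lebesgue. \<bar>fs k x - f x\<bar>)" for k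
  proof -
    have d: "integrable lebesgue (\<lambda>x. indicat_real ?K x *\<^sub>R \<bar>fs k x - f x\<bar>)"
      using integrable_abs[OF Bochner_Integration.integrable_diff[OF locally_integrableD[OF fs[of k] compact_cball] locally_integrableD[OF f compact_cball]], of 0 R 0 R]
      by (rule Bochner_Integration.integrable_cong[THEN iffD1, rotated -1]) (auto simp: indicator_def)
    have "(LINT x|lebesgue. fs k x * \<psi> x) - (LINT x|lebesgue. f x * \<psi> x) = (LINT x|lebesgue. (fs k x - f x) * \<psi> x)"
      using int[OF fs] int[OF f] by (simp add: left_diff_distrib)
    also have "\<bar>\<dots>\<bar> \<le> (LINT x|lebesgue. \<bar>(fs k x - f x) * \<psi> x\<bar>)"
      by (rule integral_abs_bound)
    also have "\<dots> \<le> (LINT x|lebesgue. B' * (indicat_real ?K x *\<^sub>R \<bar>fs k x - f x\<bar>))"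
    proof (rule integral_mono)
      show "integrable lebesgue (\<lambda>x. \<bar>(fs k x - f x) * \<psi> x\<bar>)"
        using Bochner_Integration.integrable_diff[OF int[OF fs] int[OF f]] by (simp add: left_diff_distrib)
      show "\<bar>(fs k x - f x) * \<psi> x\<bar> \<le> B' * (indicat_real ?K x *\<^sub>R \<bar>fs k x - f x\<bar>)" for x
        using mult_left_mono[OF B'[of x], of "\<bar>fs k x - f x\<bar>"] by (simp add: abs_mult mult_ac)
    qed (intro integrable_mult_right d)
    also have "\<dots> = B' * (LINT x:?K|lebesgue. \<bar>fs k x - f x\<bar>)"
      by (simp add: set_lebesgue_integral_def)
    finally show ?thesis .
  qed
  have "(\<lambda>k. B' * (LINT x:?K|lebesgue. \<bar>fs k x - f x\<bar>)) \<longlonglongrightarrow> B' * 0"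
    by (intro tendsto_intros lim compact_cball)
  then have "(\<lambda>k. B' * (LINT x:?K|lebesgue. \<bar>fs k x - f x\<bar>)) \<longlonglongrightarrow> 0"
    by simp
  then have "(\<lambda>k. (LINT x|lebesgue. fs k x * \<psi> x) - (LINT x|lebesgue. f x * \<psi> x)) \<longlonglongrightarrow> 0"
    by (rule Lim_null_comparison[rotated], intro always_eventually allI) (simp only: real_norm_def bound)
  then show ?thesis
    by (rule LIM_zero_cancel)
qed

lemma integral_partial_by_parts:
  fixes f :: "real^'n::finite \<Rightarrow> real"
  assumes f: "C_k (Suc 0) f" and g: "C_k (Suc 0) g" and R: "\<And>x. R < norm x \<Longrightarrow> g x = 0"
  shows "(LINT x|lebesgue. f x * partial i g x) = - (LINT x|lebesgue. partial i f x * g x)"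
proof -
  have p0: "partial i g x = 0" if "R < norm x" for x
    using grad_eq_0_outside[OF R that] by (simp add: grad_def vec_eq_iff)
  have cont: "continuous_on UNIV (\<lambda>x. f x * partial i g x)" "continuous_on UNIV (\<lambda>x. partial i f x * g x)"
    by (intro continuous_on_mult C1_continuous[OF f] C1_continuous[OF g]
        C1_continuous_partial[OF f] C1_continuous_partial[OF g])+
  have 1: "integrable lborel (\<lambda>x. f x * partial i g x)"
    by (rule integrable_continuous_outside[OF cont(1), of R]) (simp add: p0)
  have 2: "integrable lborel (\<lambda>x. partial i f x * g x)"
    by (rule integrable_continuous_outside[OF cont(2), of R]) (simp add: R)
  have "partial i (\<lambda>x. f x * g x) x = f x * partial i g x + partial i f x * g x" for x
    using fun_cong[OF C1_mult(2)[OF f g], of x] by (simp add: grad_def vec_eq_iff mult.commute)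
  then have "0 = (LINT x|lborel. f x * partial i g x + partial i f x * g x)"
    using integral_partial_eq_0[OF C1_mult(1)[OF f g], of R i] R by simp
  then have "(LINT x|lborel. f x * partial i g x) = - (LINT x|lborel. partial i f x * g x)"
    using 1 2 by simp
  then show ?thesis
    using borel_measurable_integrable[OF 1] borel_measurable_integrable[OF 2]
    by (simp add: integral_completion)
qed

text \<open>Local control of the \<open>L^1\<close> norm by the q-th power integral. The free
  threshold allows the measure term to be made small before the other one.\<close>

lemma set_nn_integral_norm_le:
  fixes f :: "'a::euclidean_space \<Rightarrow> 'b::euclidean_space"
  assumes [measurable]: "f \<in> borel_measurable borel" "K \<in> sets borel" and "0 < \<delta>" "1 \<le> q"
  shows "(\<integral>\<^sup>+x. ennreal (norm (f x)) * indicator K x \<partial>lborel)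
    \<le> ennreal \<delta> * emeasure lborel K + ennreal (\<delta> powr (1 - q)) * (\<integral>\<^sup>+x. ennreal (norm (f x) powr q) \<partial>lborel)"
proof -
  have "(\<integral>\<^sup>+x. ennreal (norm (f x)) * indicator K x \<partial>lborel)
      \<le> (\<integral>\<^sup>+x. ennreal \<delta> * indicator K x + ennreal (\<delta> powr (1 - q)) * ennreal (norm (f x) powr q) \<partial>lborel)"
  proof (rule nn_integral_mono)
    fix x
    have "ennreal (norm (f x)) \<le> ennreal (\<delta> + \<delta> powr (1 - q) * norm (f x) powr q)"
      by (intro ennreal_leI le_plus_powr) (use assms in auto)
    then show "ennreal (norm (f x)) * indicator K x
        \<le> ennreal \<delta> * indicator K x + ennreal (\<delta> powr (1 - q)) * ennreal (norm (f x) powr q)"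
      using assms by (auto simp: ennreal_mult'[symmetric] split: split_indicator)
  qed
  also have "\<dots> = ennreal \<delta> * emeasure lborel K + ennreal (\<delta> powr (1 - q)) * (\<integral>\<^sup>+x. ennreal (norm (f x) powr q) \<partial>lborel)"
    by (simp add: nn_integral_add nn_integral_cmult)
  finally show ?thesis .
qed

lemma locally_integrable_component:
  fixes G :: "real^'n::finite \<Rightarrow> real^'n"
  assumes [measurable]: "G \<in> borel_measurable borel" and q: "1 \<le> q"
    and fin: "(\<integral>\<^sup>+x. ennreal (norm (G x) powr q) \<partial>lborel) < \<infinity>"
  shows "locally_integrable (\<lambda>x. G x $ i)"
  unfolding locally_integrable_def set_integrable_def
proof (intro allI impI)
  fix K :: "(real^'n) set" assume K: "compact K"
  then have [measurable]: "K \<in> sets borel" by (intro borel_compact)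
  have [measurable]: "(\<lambda>x. G x $ i) \<in> borel_measurable borel"
    using borel_measurable_inner[OF assms(1), of "\<lambda>_. axis i 1"] by (simp add: inner_axis)
  have "integrable lborel (\<lambda>x. indicat_real K x *\<^sub>R (G x $ i))"
  proof (rule integrableI_bounded)
    have "(\<integral>\<^sup>+x. ennreal (norm (indicat_real K x *\<^sub>R (G x $ i))) \<partial>lborel) \<le> (\<integral>\<^sup>+x. ennreal (norm (G x)) * indicator K x \<partial>lborel)"
    proof (rule nn_integral_mono)
      fix x
      show "ennreal (norm (indicat_real K x *\<^sub>R (G x $ i))) \<le> ennreal (norm (G x)) * indicator K x"
        using ennreal_leI[OF component_le_norm_cart[of "G x" i]] by (cases "x \<in> K") simp_all
    qed
    also have "\<dots> \<le> ennreal 1 * emeasure lborel K + ennreal (1 powr (1 - q)) * (\<integral>\<^sup>+x. ennreal (norm (G x) powr q) \<partial>lborel)"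
      by (rule set_nn_integral_norm_le) (use q in auto)
    also have "\<dots> < \<infinity>"
      using fin emeasure_compact_finite[OF K] by simp
    finally show "(\<integral>\<^sup>+x. ennreal (norm (indicat_real K x *\<^sub>R (G x $ i))) \<partial>lborel) < \<infinity>" .
  qed measurable
  then show "integrable lebesgue (\<lambda>x. indicat_real K x *\<^sub>R (G x $ i))"
    using borel_measurable_integrable integrable_completion by blast
qed

lemma Lq_tendsto_imp_L1_loc:
  fixes F :: "nat \<Rightarrow> real^'n::finite \<Rightarrow> real^'n"
  assumes [measurable]: "\<And>k. F k \<in> borel_measurable borel" "G \<in> borel_measurable borel" and q: "1 \<le> q"
    and lim: "\<And>e. 0 < e \<Longrightarrow> \<exists>N. \<forall>k\<ge>N. (\<integral>\<^sup>+x. ennreal (norm (F k x - G x) powr q) \<partial>lborel) \<le> ennreal e"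
    and K: "compact K"
  shows "(\<lambda>k. LINT x:K|lebesgue. \<bar>F k x $ i - G x $ i\<bar>) \<longlonglongrightarrow> 0"
proof (rule LIMSEQ_I)
  fix e :: real assume e: "0 < e"
  have [measurable]: "K \<in> sets borel" using K by (intro borel_compact)
  have comp [measurable]: "(\<lambda>x. H x $ i) \<in> borel_measurable borel" if "H \<in> borel_measurable borel" for H :: "real^'n \<Rightarrow> real^'n"
    using borel_measurable_inner[OF that, of "\<lambda>_. axis i 1"] by (simp add: inner_axis)
  define \<mu> where "\<mu> = measure lborel K"
  have \<mu>: "emeasure lborel K = ennreal \<mu>"
    using emeasure_compact_finite[OF K] by (simp add: \<mu>_def emeasure_eq_ennreal_measure)
  \<comment> \<open>\<delta> keeps the measure term below \<open>e / 4\<close>, with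
    \<open>\<mu> + 1\<close> guarding against a null set \<open>K\<close>; \<eta> is then chosen for
    this \<delta> so that the other term equals \<open>e / 4\<close>.\<close>
  define \<delta> where "\<delta> = e / (4 * (\<mu> + 1))"
  have \<mu>0: "0 \<le> \<mu>" by (simp add: \<mu>_def)
  have \<delta>: "0 < \<delta>" using e \<mu>0 by (simp add: \<delta>_def)
  define \<eta> where "\<eta> = e / (4 * \<delta> powr (1 - q))"
  have \<eta>: "0 < \<eta>" using e \<delta> by (simp add: \<eta>_def)
  obtain N where N: "\<And>k. N \<le> k \<Longrightarrow> (\<integral>\<^sup>+x. ennreal (norm (F k x - G x) powr q) \<partial>lborel) \<le> ennreal \<eta>"
    using lim[OF \<eta>] by blast
  have "norm ((LINT x:K|lebesgue. \<bar>F k x $ i - G x $ i\<bar>) - 0) < e" if "N \<le> k" for k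
  proof -
    have "(\<integral>\<^sup>+x. ennreal (indicat_real K x *\<^sub>R \<bar>F k x $ i - G x $ i\<bar>) \<partial>lborel)
        \<le> (\<integral>\<^sup>+x. ennreal (norm (F k x - G x)) * indicator K x \<partial>lborel)"
    proof (rule nn_integral_mono)
      fix x
      show "ennreal (indicat_real K x *\<^sub>R \<bar>F k x $ i - G x $ i\<bar>) \<le> ennreal (norm (F k x - G x)) * indicator K x"
        using ennreal_leI[OF component_le_norm_cart[of "F k x - G x" i]] by (cases "x \<in> K") simp_all
    qed
    also have "\<dots> \<le> ennreal \<delta> * emeasure lborel K + ennreal (\<delta> powr (1 - q)) * (\<integral>\<^sup>+x. ennreal (norm (F k x - G x) powr q) \<partial>lborel)"
      by (rule set_nn_integral_norm_le) (use q \<delta> in auto)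
    also have "\<dots> \<le> ennreal \<delta> * ennreal \<mu> + ennreal (\<delta> powr (1 - q)) * ennreal \<eta>"
      unfolding \<mu> by (intro add_left_mono mult_left_mono N that) auto
    also have "\<dots> = ennreal (\<delta> * \<mu> + \<delta> powr (1 - q) * \<eta>)"
      using \<delta> \<eta> \<mu>0 by (simp add: ennreal_mult'[symmetric])
    also have "\<delta> * \<mu> + \<delta> powr (1 - q) * \<eta> = e / 4 * (\<mu> / (\<mu> + 1)) + e / 4"
      using \<delta> by (simp add: \<eta>_def) (simp add: \<delta>_def)
    finally have le: "(\<integral>\<^sup>+x. ennreal (indicat_real K x *\<^sub>R \<bar>F k x $ i - G x $ i\<bar>) \<partial>lborel) \<le> ennreal (e / 4 * (\<mu> / (\<mu> + 1)) + e / 4)" .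
    have "(LINT x:K|lebesgue. \<bar>F k x $ i - G x $ i\<bar>) = (LINT x|lborel. indicat_real K x *\<^sub>R \<bar>F k x $ i - G x $ i\<bar>)"
      unfolding set_lebesgue_integral_def by (rule integral_completion) measurable
    also have "\<dots> = enn2real (\<integral>\<^sup>+x. ennreal (indicat_real K x *\<^sub>R \<bar>F k x $ i - G x $ i\<bar>) \<partial>lborel)"
      by (rule integral_eq_nn_integral) auto
    also have "\<dots> \<le> e / 4 * (\<mu> / (\<mu> + 1)) + e / 4"
      using le e \<mu>0 by (intro enn2real_leI) auto
    also have "\<dots> \<le> e / 4 * 1 + e / 4"
      using e \<mu>0 by (intro add_right_mono mult_left_mono) auto
    also have "\<dots> < e" using e by simp
    finally show ?thesis
      by (simp add: set_lebesgue_integral_def)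
  qed
  then show "\<exists>N. \<forall>k\<ge>N. norm ((LINT x:K|lebesgue. \<bar>F k x $ i - G x $ i\<bar>) - 0) < e" by blast
qed

text \<open>Links the arbitrary choice in \<open>weak_grad\<close> to any weak gradient constructed
  explicitly.\<close>

lemma weak_gradient_unique:
  assumes G: "is_weak_gradient u G" and H: "is_weak_gradient u H"
  shows "AE x in lebesgue. G x = H x"
proof -
  have "AE x in lebesgue. G x $ i - H x $ i = 0" for i
  proof (rule du_Bois_Reymond)
    have li: "locally_integrable (\<lambda>x. G x $ i)" "locally_integrable (\<lambda>x. H x $ i)"
      using G H by (auto simp: is_weak_gradient_def)
    show "locally_integrable (\<lambda>x. G x $ i - H x $ i)"
      using li by (auto simp: locally_integrable_def intro!: set_integral_diff)
    fix \<phi> :: "real^'a \<Rightarrow> real" assume \<phi>: "\<phi> \<in> test_functions UNIV"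
    obtain R where R: "\<And>x. R < norm x \<Longrightarrow> \<phi> x = 0"
      using test_function_C1(2)[OF \<phi>] by blast
    have c: "continuous_on UNIV \<phi>"
      by (rule C1_continuous[OF test_function_C1(1)[OF \<phi>]])
    have "compact (\<phi> ` cball 0 R)"
      by (intro compact_continuous_image continuous_on_subset[OF c]) auto
    then obtain B where B: "\<And>x. x \<in> cball 0 R \<Longrightarrow> \<bar>\<phi> x\<bar> \<le> B"
      by (force dest!: compact_imp_bounded simp: bounded_iff)
    have int: "integrable lebesgue (\<lambda>x. f x * \<phi> x)" if "locally_integrable f" for f
    proof (rule locally_integrable_mult_bounded[OF that compact_cball])
      show "\<phi> \<in> borel_measurable borel" by (rule borel_measurable_continuous_onI[OF c])
      show "\<bar>\<phi> x\<bar> \<le> max B 0" for x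
        using B[of x] R[of x] by (cases "x \<in> cball 0 R") auto
      show "\<phi> x = 0" if "x \<notin> cball 0 R" for x using that R by simp
    qed
    have "(LINT x|lebesgue. G x $ i * \<phi> x) = (LINT x|lebesgue. H x $ i * \<phi> x)"
    proof -
      have "(LINT x|lebesgue. u x * partial i \<phi> x) = - (LINT x|lebesgue. G x $ i * \<phi> x)"
        using G \<phi> by (simp add: is_weak_gradient_def)
      moreover have "(LINT x|lebesgue. u x * partial i \<phi> x) = - (LINT x|lebesgue. H x $ i * \<phi> x)"
        using H \<phi> by (simp add: is_weak_gradient_def)
      ultimately show ?thesis by simp
    qed
    then show "(LINT x|lebesgue. (G x $ i - H x $ i) * \<phi> x) = 0"
      using int[OF li(1)] int[OF li(2)] by (simp add: left_diff_distrib)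
  qed
  then have "AE x in lebesgue. \<forall>i. G x $ i - H x $ i = 0"
    by (subst AE_all_countable) blast
  then show ?thesis
    by eventually_elim (simp add: vec_eq_iff)
qed

section \<open>The completion\<close>


text \<open>\<open>grad_norm\<close> rests on a Bochner integral, whose value for non-integrable
  functions is 0. Compact support excludes this, so smallness of \<open>grad_norm\<close> really is
  smallness of the energy.\<close>

lemma nn_integral_grad_powr_eq:
  fixes f :: "real^'n::finite \<Rightarrow> real"
  assumes C1: "C_k (Suc 0) f" and R: "\<And>x. R < norm x \<Longrightarrow> f x = 0" and q: "0 < q"
  shows "(\<integral>\<^sup>+x. ennreal (norm (grad f x) powr q) \<partial>lborel) = ennreal (grad_norm q f powr q)"
proof -
  have c: "continuous_on UNIV (\<lambda>x. norm (grad f x) powr q)"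
    using q by (intro continuous_on_powr' continuous_on_norm C1_continuous_grad[OF C1] continuous_on_const) auto
  have int: "integrable lborel (\<lambda>x. norm (grad f x) powr q)"
    by (rule integrable_continuous_outside[OF c, of R]) (simp add: grad_eq_0_outside[OF R])
  have "(LINT x|lebesgue. norm (grad f x) powr q) = (LINT x|lborel. norm (grad f x) powr q)"
    by (rule integral_completion) (use borel_measurable_integrable[OF int] in simp)
  moreover have "0 \<le> (LINT x|lborel. norm (grad f x) powr q)" by simp
  ultimately have "grad_norm q f powr q = (LINT x|lborel. norm (grad f x) powr q)"
    using q by (simp add: grad_norm_def powr_powr)
  then show ?thesis
    using nn_integral_eq_integral[OF int] by simp
qed

lemma continuous_on_weight:
  fixes blk :: "'n::finite \<Rightarrow> 'm::finite"
  assumes bs: "block_structure \<gamma> blk" and nm: "real CARD('m) < real (\<Sum>k\<in>UNIV. \<gamma> k)"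
  shows "continuous_on S (weight \<gamma> blk)"
  unfolding weight_def[abs_def]
proof (rule continuous_on_prod)
  fix j
  have "continuous_on S (\<lambda>x. block_norm blk j x powr ((real (\<gamma> j) - 1) / (real (\<Sum>k\<in>UNIV. \<gamma> k) - real CARD('m))))"
    if "\<gamma> j \<noteq> 1"
  proof (rule continuous_on_powr')
    show "continuous_on S (block_norm blk j)"
      unfolding block_norm_def[abs_def] L2_set_def by (intro continuous_intros)
    have "0 < (real (\<gamma> j) - 1) / (real (\<Sum>k\<in>UNIV. \<gamma> k) - real CARD('m))"
      using that nm block_structure_card(1)[OF bs, of j] by (intro divide_pos_pos) auto
    then show "\<forall>x\<in>S. 0 \<le> block_norm blk j x \<and> (block_norm blk j x = 0 \<longrightarrow>
        0 < (real (\<gamma> j) - 1) / (real (\<Sum>k\<in>UNIV. \<gamma> k) - real CARD('m)))"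
      by simp
  qed (rule continuous_on_const)
  then show "continuous_on S (\<lambda>x. if \<gamma> j = 1 then 1
      else block_norm blk j x powr ((real (\<gamma> j) - 1) / (real (\<Sum>k\<in>UNIV. \<gamma> k) - real CARD('m))))"
    by (cases "\<gamma> j = 1") simp_all
qed

lemma weight_eq_0:
  assumes "x \<in> singular_set \<gamma> blk"
  shows "weight \<gamma> blk x = 0"
proof -
  obtain k where "2 \<le> \<gamma> k" "block_norm blk k x = 0"
    using assms by (auto simp: singular_set_def)
  then show ?thesis
    unfolding weight_def by (intro prod_zero finite bexI[of _ k]) auto
qed

text \<open>The superlevel sets of the weight are open, and on each of them the pointwise estimate
  is uniform; continuity of the limit is proved on each and then glued.\<close>

lemma singular_set_eq_weight:
  fixes blk :: "'n::finite \<Rightarrow> 'm::finite"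
  assumes "block_structure \<gamma> blk" "real CARD('m) < real (\<Sum>k\<in>UNIV. \<gamma> k)"
  shows "- singular_set \<gamma> blk = (\<Union>c\<in>{0<..}. {x. c < weight \<gamma> blk x})"
proof
  show "- singular_set \<gamma> blk \<subseteq> (\<Union>c\<in>{0<..}. {x. c < weight \<gamma> blk x})"
    using weight_powr_eq(1)[OF assms] dense by (fastforce simp del: of_nat_sum)
  show "(\<Union>c\<in>{0<..}. {x. c < weight \<gamma> blk x}) \<subseteq> - singular_set \<gamma> blk"
    using weight_eq_0[of _ \<gamma> blk] by force
qed

lemma null_sets_singular_set:
  fixes blk :: "'n::finite \<Rightarrow> 'm::finite"
  assumes bs: "block_structure \<gamma> blk"
  shows "singular_set \<gamma> blk \<in> null_sets lebesgue"
proof -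
  have "singular_set \<gamma> blk \<subseteq> (\<Union>k. {x. axis (block_coord blk k) 1 \<bullet> x = 0})"
  proof
    fix x assume "x \<in> singular_set \<gamma> blk"
    then obtain k where "block_norm blk k x = 0" by (auto simp: singular_set_def)
    then have "x $ block_coord blk k = 0"
      using blk_block_coord[OF bs, of k] by (simp add: block_norm_def L2_set_eq_0_iff)
    then show "x \<in> (\<Union>k. {x. axis (block_coord blk k) 1 \<bullet> x = 0})"
      by (auto simp: inner_axis')
  qed
  moreover have "negligible (\<Union>k. {x::real^'n. axis (block_coord blk k) 1 \<bullet> x = 0})"
    by (rule negligible_Union) (auto intro!: negligible_hyperplane simp: axis_eq_0_iff)
  ultimately show ?thesis
    using negligible_subset negligible_iff_null_sets by blast
qed

text \<open>Any approximating sequence for the smaller class is one for the larger class, so the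
  estimate on \<open>H_dot\<close> carries over.\<close>

lemma H_dot_0_subset_H_dot:
  fixes blk :: "'n::finite \<Rightarrow> 'm::finite"
  shows "H_dot_0 q \<gamma> blk \<subseteq> H_dot q blk"
proof -
  have "grad_completion q X \<subseteq> grad_completion q Y" if "X \<subseteq> Y" for X Y :: "(real^'n \<Rightarrow> real) set"
    using that unfolding grad_completion_def by (intro Collect_mono conj_mono ex_mono imp_refl) blast
  then show ?thesis
    unfolding H_dot_0_def H_dot_def test_functions_def by (simp add: Collect_mono_iff)
qed

text \<open>Two limits of one approximating sequence: the gradients converge in \<open>L^q\<close>
  to a weak gradient \<open>G\<close> of \<open>u\<close>, and the functions converge locally
  uniformly off the singular set to the continuous representative \<open>v\<close>.\<close>

lemma sup_estimate_H_dot: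
  fixes \<gamma> :: "'m::finite \<Rightarrow> nat" and blk :: "'n::finite \<Rightarrow> 'm" and q :: real
  assumes bs: "block_structure \<gamma> blk" and q: "1 < q" "real CARD('m) < q" "q < real (\<Sum>k\<in>UNIV. \<gamma> k)"
    and u: "u \<in> H_dot q blk"
  shows "sup_estimate_and_continuity (2 * sup_const q \<gamma> blk) q \<gamma> blk u"
proof -
  define n where "n = real (\<Sum>k\<in>UNIV. \<gamma> k)"
  define S where "S = sup_const q \<gamma> blk"
  define w where "w = weight \<gamma> blk"
  have nm: "real CARD('m) < real (\<Sum>k\<in>UNIV. \<gamma> k)" using q by simp
  have qn: "0 < n - q" using q by (simp add: n_def)
  have S: "0 < S" using sup_const_pos[OF bs q] by (simp add: S_def)
  obtain \<phi> where uli: "locally_integrable u"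
    and \<phi>: "\<And>k. \<phi> k \<in> test_functions UNIV" "\<And>k. block_invariant blk (\<phi> k)"
    and Cauchy: "\<And>e. 0 < e \<Longrightarrow> \<exists>N. \<forall>k\<ge>N. \<forall>l\<ge>N. grad_norm q (\<lambda>x. \<phi> k x - \<phi> l x) < e"
    and L1: "\<And>K. compact K \<Longrightarrow> (\<lambda>k. LINT x:K|lebesgue. \<bar>\<phi> k x - u x\<bar>) \<longlonglongrightarrow> 0"
    using u unfolding H_dot_def grad_completion_def by auto
  have C1: "C_k (Suc 0) (\<phi> k)" for k
    by (rule test_function_C1(1)[OF \<phi>(1)])
  obtain R where R: "\<And>k x. R k < norm x \<Longrightarrow> \<phi> k x = 0"
    using test_function_C1(2)[OF \<phi>(1)] by metis
  have C1d: "C_k (Suc 0) (\<lambda>x. \<phi> k x - \<phi> l x)"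
    and gd: "grad (\<lambda>x. \<phi> k x - \<phi> l x) = (\<lambda>x. grad (\<phi> k) x - grad (\<phi> l) x)" for k l
    using C1_diff[OF C1 C1] by blast+
  have Rd: "\<phi> k x - \<phi> l x = 0" if "max (R k) (R l) < norm x" for k l x
    using R that by simp
  have invd: "block_invariant blk (\<lambda>x. \<phi> k x - \<phi> l x)" for k l
    using \<phi>(2) by (simp add: block_invariant_def)
  have Fm [measurable]: "grad (\<phi> k) \<in> borel_measurable borel" for k
    by (intro borel_measurable_continuous_onI C1_continuous_grad C1)
  have normd: "(\<integral>\<^sup>+x. ennreal (norm (grad (\<phi> k) x - grad (\<phi> l) x) powr q) \<partial>lborel)
      = ennreal (grad_norm q (\<lambda>x. \<phi> k x - \<phi> l x) powr q)" for k l
    using nn_integral_grad_powr_eq[OF C1d, of "max (R k) (R l)" k l q] Rd[of k l] q by (simp add: gd)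
  have CauchyF: "\<exists>N. \<forall>k\<ge>N. \<forall>l\<ge>N. (\<integral>\<^sup>+x. ennreal (norm (grad (\<phi> k) x - grad (\<phi> l) x) powr q) \<partial>lborel) \<le> ennreal e"
    if e: "0 < e" for e
  proof -
    obtain N where N: "\<And>k l. N \<le> k \<Longrightarrow> N \<le> l \<Longrightarrow> grad_norm q (\<lambda>x. \<phi> k x - \<phi> l x) < e powr (1 / q)"
      using Cauchy[of "e powr (1 / q)"] e by auto
    have "(\<integral>\<^sup>+x. ennreal (norm (grad (\<phi> k) x - grad (\<phi> l) x) powr q) \<partial>lborel) \<le> ennreal e"
      if kl: "N \<le> k" "N \<le> l" for k l
    proof -
      have "grad_norm q (\<lambda>x. \<phi> k x - \<phi> l x) powr q \<le> (e powr (1 / q)) powr q"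
        using N[OF kl] q by (intro powr_mono2) (auto simp: grad_norm_def)
      also have "\<dots> = e" using e q by (simp add: powr_powr)
      finally show ?thesis
        unfolding normd by (rule ennreal_leI)
    qed
    then show ?thesis by blast
  qed
  obtain G where Gm [measurable]: "G \<in> borel_measurable borel"
    and FG: "\<And>e. 0 < e \<Longrightarrow> \<exists>N. \<forall>k\<ge>N. (\<integral>\<^sup>+x. ennreal (norm (grad (\<phi> k) x - G x) powr q) \<partial>lborel) \<le> ennreal e"
    using Cauchy_Lq_limit[of "\<lambda>k. grad (\<phi> k)" lborel q] CauchyF q by auto
  have Ffin: "(\<integral>\<^sup>+x. ennreal (norm (grad (\<phi> k) x) powr q) \<partial>lborel) < \<infinity>" for k
    using nn_integral_grad_powr_eq[OF C1, of "R k" k q] R q by simp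
  have Gfin: "(\<integral>\<^sup>+x. ennreal (norm (G x) powr q) \<partial>lborel) < \<infinity>"
  proof -
    obtain N where N: "(\<integral>\<^sup>+x. ennreal (norm (grad (\<phi> N) x - G x) powr q) \<partial>lborel) \<le> ennreal 1"
      using FG[of 1] by auto
    have "(\<integral>\<^sup>+x. ennreal (norm (G x) powr q) \<partial>lborel) \<le> ennreal (2 powr q) *
        ((\<integral>\<^sup>+x. ennreal (norm (G x - grad (\<phi> N) x) powr q) \<partial>lborel) + (\<integral>\<^sup>+x. ennreal (norm (grad (\<phi> N) x) powr q) \<partial>lborel))"
      using q by (intro nn_integral_norm_powr_le) auto
    also have "\<dots> < \<infinity>"
      using le_less_trans[OF N] Ffin[of N] by (simp add: norm_minus_commute ennreal_mult_less_top)
    finally show ?thesis .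
  qed
  \<comment> \<open>Integration by parts holds for each \<open>\<phi> k\<close>. The left side
    converges by \<open>L^1\<close> convergence on compact sets, the right side because
    \<open>L^q\<close> convergence implies it for the gradients.\<close>
  have wG: "is_weak_gradient u G"
    unfolding is_weak_gradient_def
  proof (intro conjI allI ballI uli)
    show Gli: "locally_integrable (\<lambda>x. G x $ i)" for i
      by (rule locally_integrable_component[OF Gm _ Gfin]) (use q in simp)
    fix \<psi> :: "real^'n \<Rightarrow> real" and i assume \<psi>: "\<psi> \<in> test_functions UNIV"
    have \<psi>1: "C_k (Suc 0) \<psi>" by (rule test_function_C1(1)[OF \<psi>])
    obtain R' where R': "\<And>x. R' < norm x \<Longrightarrow> \<psi> x = 0"
      using test_function_C1(2)[OF \<psi>] by blast
    have p0: "partial i \<psi> x = 0" if "R' < norm x" for x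
      using grad_eq_0_outside[OF R' that] by (simp add: grad_def vec_eq_iff)
    have lim1: "(\<lambda>k. LINT x|lebesgue. \<phi> k x * partial i \<psi> x) \<longlonglongrightarrow> (LINT x|lebesgue. u x * partial i \<psi> x)"
      by (rule L1_loc_pairing_tendsto[OF uli _ L1 C1_continuous_partial[OF \<psi>1] p0])
        (intro locally_integrable_continuous C1_continuous C1)
    have lim2: "(\<lambda>k. LINT x|lebesgue. grad (\<phi> k) x $ i * \<psi> x) \<longlonglongrightarrow> (LINT x|lebesgue. G x $ i * \<psi> x)"
    proof (rule L1_loc_pairing_tendsto[OF Gli _ _ C1_continuous[OF \<psi>1] R'])
      show "locally_integrable (\<lambda>x. grad (\<phi> k) x $ i)" for k
        by (rule locally_integrable_component[OF Fm _ Ffin]) (use q in simp)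
      show "(\<lambda>k. LINT x:K|lebesgue. \<bar>grad (\<phi> k) x $ i - G x $ i\<bar>) \<longlonglongrightarrow> 0" if "compact K" for K
        by (rule Lq_tendsto_imp_L1_loc[OF Fm Gm _ FG that]) (use q in simp_all)
    qed
    have parts: "(LINT x|lebesgue. \<phi> k x * partial i \<psi> x) = - (LINT x|lebesgue. grad (\<phi> k) x $ i * \<psi> x)" for k
      using integral_partial_by_parts[OF C1 \<psi>1, of R' k i] R' by (simp add: grad_def)
    show "(LINT x|lebesgue. u x * partial i \<psi> x) = - (LINT x|lebesgue. G x $ i * \<psi> x)"
      by (rule LIMSEQ_unique[OF lim1[unfolded parts] tendsto_minus[OF lim2]])
  qed
  define E where "E = (LINT x|lborel. norm (G x) powr q)"
  have E0: "0 \<le> E" by (simp add: E_def)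
  have Gint: "integrable lborel (\<lambda>x. norm (G x) powr q)"
    using Gfin by (intro integrableI_bounded) auto
  have EG: "(\<integral>\<^sup>+x. ennreal (norm (G x) powr q) \<partial>lborel) = ennreal E"
    unfolding E_def by (rule nn_integral_eq_integral[OF Gint]) simp
  have Ew: "(LINT x|lebesgue. norm (weak_grad u x) powr q) = E"
  proof -
    have H: "is_weak_gradient u (weak_grad u)"
      unfolding weak_grad_def using wG by (rule someI[of "is_weak_gradient u"])
    have "AE x in lebesgue. weak_grad u x = G x"
      by (rule weak_gradient_unique[OF H wG])
    then have "(LINT x|lebesgue. norm (weak_grad u x) powr q) = (LINT x|lebesgue. norm (G x) powr q)"
    proof (intro integral_cong_AE)
      have "(\<lambda>x. weak_grad u x $ i) \<in> borel_measurable lebesgue" for i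
        using H by (auto simp: is_weak_gradient_def intro: locally_integrable_measurable)
      then have "weak_grad u \<in> borel_measurable lebesgue"
        by (subst borel_measurable_euclidean_space) (auto simp: Basis_vec_def inner_axis)
      then show "(\<lambda>x. norm (weak_grad u x) powr q) \<in> borel_measurable lebesgue"
        by measurable
      show "(\<lambda>x. norm (G x) powr q) \<in> borel_measurable lebesgue"
        by (rule measurable_completion) measurable
    qed (auto elim: eventually_mono)
    also have "\<dots> = E"
      unfolding E_def by (rule integral_completion) measurable
    finally show ?thesis .
  qed
  \<comment> \<open>On the singular set the limit may fail to exist and \<open>v\<close> is
    arbitrary; the weight vanishes there, so the estimate is unaffected.\<close>
  define v where "v x = lim (\<lambda>k. \<phi> k x)" for x
  have unif: "uniform_limit {x. c < w x} \<phi> v sequentially" if c: "0 < c" for c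
  proof -
    have "uniformly_Cauchy_on {x. c < w x} \<phi>"
    proof (rule uniformly_Cauchy_onI)
      fix e :: real assume e: "0 < e"
      \<comment> \<open>Solves \<open>S powr q * \<eta> = c powr (n - q) * e powr q\<close>. Where
        the weight exceeds \<open>c\<close>, a gap of at least \<open>e\<close> then contradicts the
        pointwise estimate for a difference of energy at most \<eta>.\<close>
      define \<eta> where "\<eta> = c powr (n - q) * e powr q / (S powr q)"
      have \<eta>: "0 < \<eta>" using c e S by (simp add: \<eta>_def)
      obtain N where N: "\<And>k l. N \<le> k \<Longrightarrow> N \<le> l \<Longrightarrow>
          (\<integral>\<^sup>+x. ennreal (norm (grad (\<phi> k) x - grad (\<phi> l) x) powr q) \<partial>lborel) \<le> ennreal \<eta>"
        using CauchyF[OF \<eta>] by blast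
      have "dist (\<phi> k x) (\<phi> l x) < e" if x: "c < w x" and kl: "N \<le> k" "N \<le> l" for x k l
      proof (rule ccontr)
        assume "\<not> ?thesis"
        then have "e powr q \<le> \<bar>\<phi> k x - \<phi> l x\<bar> powr q"
          using e q by (intro powr_mono2) (auto simp: dist_real_def)
        have "x \<notin> singular_set \<gamma> blk"
          using weight_eq_0[of x \<gamma> blk] x c by (auto simp: w_def)
        then have "w x powr (n - q) * \<bar>\<phi> k x - \<phi> l x\<bar> powr q \<le> S powr q * \<eta>"
          using pointwise_estimate[OF bs q C1d _ invd _ \<eta>, of "max (R k) (R l)" k l x] Rd[of k l] N[OF kl]
          by (simp add: gd w_def n_def S_def)
        moreover have "c powr (n - q) * e powr q < w x powr (n - q) * \<bar>\<phi> k x - \<phi> l x\<bar> powr q"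
        proof (rule mult_less_le_imp_less)
          show "c powr (n - q) < w x powr (n - q)"
            using x c qn by (intro powr_less_mono2) auto
        qed (use \<open>e powr q \<le> _\<close> e in auto)
        moreover have "S powr q * \<eta> = c powr (n - q) * e powr q"
          using S by (simp add: \<eta>_def)
        ultimately show False by simp
      qed
      then show "\<exists>N. \<forall>x\<in>{x. c < w x}. \<forall>k\<ge>N. \<forall>l\<ge>N. dist (\<phi> k x) (\<phi> l x) < e"
        by blast
    qed
    then show ?thesis
      unfolding v_def using Cauchy_uniformly_convergent uniformly_convergent_uniform_limit_iff by blast
  qed
  have v_lim: "(\<lambda>k. \<phi> k x) \<longlonglongrightarrow> v x" if x: "x \<notin> singular_set \<gamma> blk" for x
  proof -
    obtain c where "0 < c" "c < w x"
      using weight_powr_eq(1)[OF bs nm x] dense by (auto simp: w_def)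
    then show ?thesis
      using tendsto_uniform_limitI[OF unif] by blast
  qed
  have contv: "continuous_on (- singular_set \<gamma> blk) v"
    unfolding singular_set_eq_weight[OF bs nm]
  proof (rule continuous_on_open_UN)
    show "open {x. c < weight \<gamma> blk x}" for c
      by (intro open_Collect_less continuous_on_const continuous_on_weight[OF bs nm])
    show "continuous_on {x. c < weight \<gamma> blk x} v" if "c \<in> {0<..}" for c
    proof (rule uniform_limit_theorem)
      show "uniform_limit {x. c < weight \<gamma> blk x} \<phi> v sequentially"
        using unif that by (simp add: w_def)
    qed (auto intro!: always_eventually C1_continuous[OF C1])
  qed
  have vu: "AE x in lebesgue. v x = u x"
  proof -
    \<comment> \<open>\<open>L^1\<close> convergence on a ball gives a subsequence converging to
      \<open>u\<close> almost everywhere, while off the singular set the whole sequence converges to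
      \<open>v\<close>.\<close>
    have "AE x in lebesgue. x \<in> cball 0 (real j) \<longrightarrow> x \<notin> singular_set \<gamma> blk \<longrightarrow> v x = u x" for j :: nat
    proof -
      define h where "h k x = indicat_real (cball 0 (real j)) x *\<^sub>R (\<phi> k x - u x)" for k and x :: "real^'n"
      have hint: "integrable lebesgue (h k)" for k
        unfolding h_def scaleR_diff_right
        by (intro Bochner_Integration.integrable_diff locally_integrableD locally_integrable_continuous C1_continuous C1 uli compact_cball)
      have "(\<lambda>k. LINT x|lebesgue. norm (h k x)) \<longlonglongrightarrow> 0"
        using L1[of "cball 0 (real j)"] by (simp add: h_def set_lebesgue_integral_def abs_mult)
      then obtain r where r: "strict_mono r" "AE x in lebesgue. (\<lambda>k. h (r k) x) \<longlonglongrightarrow> 0"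
        using tendsto_L1_AE_subseq[of lebesgue h] hint by blast
      show ?thesis
        using r(2)
      proof eventually_elim
        case (elim x)
        show ?case
        proof (intro impI)
          assume x: "x \<in> cball 0 (real j)" "x \<notin> singular_set \<gamma> blk"
          then have "(\<lambda>k. \<phi> (r k) x - u x) \<longlonglongrightarrow> 0"
            using elim by (simp add: h_def)
          moreover have "(\<lambda>k. \<phi> (r k) x - u x) \<longlonglongrightarrow> v x - u x"
            using LIMSEQ_subseq_LIMSEQ[OF v_lim[OF x(2)] r(1)] by (intro tendsto_diff tendsto_const) (simp add: o_def)
          ultimately show "v x = u x"
            using LIMSEQ_unique by fastforce
        qed
      qed
    qed
    then have "AE x in lebesgue. \<forall>j::nat. x \<in> cball 0 (real j) \<longrightarrow> x \<notin> singular_set \<gamma> blk \<longrightarrow> v x = u x"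
      by (subst AE_all_countable) blast
    moreover have "AE x in lebesgue. x \<notin> singular_set \<gamma> blk"
      by (rule AE_not_in[OF null_sets_singular_set[OF bs]])
    ultimately show ?thesis
    proof eventually_elim
      case (elim x)
      obtain j :: nat where "norm x \<le> real j" using real_arch_simple by blast
      then have "x \<in> cball 0 (real j)" by simp
      then show ?case using elim by blast
    qed
  qed
  have sup: "w x powr (n - q) * \<bar>v x\<bar> powr q \<le> (2 * S) powr q * E" for x
  proof (cases "x \<in> singular_set \<gamma> blk")
    case True
    then show ?thesis using weight_eq_0[OF True] E0 by (simp add: w_def)
  next
    case False
    \<comment> \<open>The slack \<open>e\<close> bounds the distance of the gradients from
      \<open>G\<close> and keeps the energy bound positive even when \<open>E = 0\<close>; it is
      removed by letting \<open>e\<close> tend to 0.\<close>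
    have le: "w x powr (n - q) * \<bar>v x\<bar> powr q \<le> S powr q * (2 powr q * (e + E))" if e: "0 < e" for e
    proof -
      obtain N where N: "\<And>k. N \<le> k \<Longrightarrow> (\<integral>\<^sup>+x. ennreal (norm (grad (\<phi> k) x - G x) powr q) \<partial>lborel) \<le> ennreal e"
        using FG[OF e] by blast
      have ev: "w x powr (n - q) * \<bar>\<phi> k x\<bar> powr q \<le> S powr q * (2 powr q * (e + E))" if k: "N \<le> k" for k
      proof -
        have "(\<integral>\<^sup>+x. ennreal (norm (grad (\<phi> k) x) powr q) \<partial>lborel) \<le> ennreal (2 powr q) *
            ((\<integral>\<^sup>+x. ennreal (norm (grad (\<phi> k) x - G x) powr q) \<partial>lborel) + (\<integral>\<^sup>+x. ennreal (norm (G x) powr q) \<partial>lborel))"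
          using q by (intro nn_integral_norm_powr_le) auto
        also have "\<dots> \<le> ennreal (2 powr q) * (ennreal e + ennreal E)"
          unfolding EG by (intro mult_left_mono add_right_mono N k) simp
        also have "\<dots> = ennreal (2 powr q * (e + E))"
          using e E0 by (simp add: ennreal_mult'[symmetric] ennreal_plus[symmetric] del: ennreal_plus)
        finally have le: "(\<integral>\<^sup>+x. ennreal (norm (grad (\<phi> k) x) powr q) \<partial>lborel) \<le> ennreal (2 powr q * (e + E))" .
        have "0 < 2 powr q * (e + E)" using e E0 by (simp add: add_pos_nonneg)
        then show ?thesis
          using pointwise_estimate[OF bs q C1 _ \<phi>(2) False _ le, of "R k"] R by (simp add: w_def n_def S_def)
      qed
      have "(\<lambda>k. w x powr (n - q) * \<bar>\<phi> k x\<bar> powr q) \<longlonglongrightarrow> w x powr (n - q) * \<bar>v x\<bar> powr q"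
        using q by (intro tendsto_mult tendsto_const tendsto_powr' tendsto_rabs v_lim[OF False]) auto
      then show ?thesis
        by (rule LIMSEQ_le_const2) (use ev in blast)
    qed
    have "((\<lambda>e. S powr q * (2 powr q * (e + E))) \<longlongrightarrow> S powr q * (2 powr q * (0 + E))) (at_right 0)"
      by (intro tendsto_intros)
    moreover have "\<forall>\<^sub>F e in at_right 0. w x powr (n - q) * \<bar>v x\<bar> powr q \<le> S powr q * (2 powr q * (e + E))"
      using eventually_at_right_less[of 0] by eventually_elim (rule le)
    ultimately have "w x powr (n - q) * \<bar>v x\<bar> powr q \<le> S powr q * (2 powr q * (0 + E))"
      by (rule tendsto_lowerbound) simp
    then show ?thesis using S by (simp add: powr_mult mult_ac)
  qed
  show ?thesis
    unfolding sup_estimate_and_continuity_def Ew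
  proof (intro exI[of _ v] conjI vu contv SUP_least ennreal_leI)
    show "weight \<gamma> blk x powr (real (\<Sum>k\<in>UNIV. \<gamma> k) - q) * \<bar>v x\<bar> powr q \<le> (2 * sup_const q \<gamma> blk) powr q * E" for x
      using sup[of x] by (simp only: w_def n_def S_def)
  qed
qed

theorem corollary1:
  fixes \<gamma> :: "'m::finite \<Rightarrow> nat" and blk :: "'n::finite \<Rightarrow> 'm" and q :: real
  assumes "block_structure \<gamma> blk"
    and "1 < CARD('m)"
    and "real CARD('m) < q"
    and "q < real (\<Sum>k\<in>UNIV. \<gamma> k)"
  shows "\<exists>C>0.
    (\<forall>u \<in> H_dot_0 q \<gamma> blk. sup_estimate_and_continuity C q \<gamma> blk u) \<and>
    (q < real (Min (\<gamma> ` {k. 2 \<le> \<gamma> k})) \<longrightarrow>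
       (\<forall>u \<in> H_dot q blk. sup_estimate_and_continuity C q \<gamma> blk u))"
proof -
  have q: "1 < q" using assms(2,3) by linarith
  have "0 < 2 * sup_const q \<gamma> blk"
    using sup_const_pos[OF assms(1) q assms(3,4)] by simp
  moreover have "sup_estimate_and_continuity (2 * sup_const q \<gamma> blk) q \<gamma> blk u" if "u \<in> H_dot q blk" for u
    by (rule sup_estimate_H_dot[OF assms(1) q assms(3,4) that])
  ultimately show ?thesis
    using H_dot_0_subset_H_dot[of q \<gamma> blk] by blast
qed

end
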